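(* Let $(\mathcal S,\mathcal A,p)$ satisfy the assumptions of Model 1 (stated in the context). Then there exist $0<q_0<q_1\le 1$ such that every Local Learning Process $(X_n,A_n,\beta_n)_{n\ge 0}$ in $(\mathcal S,\mathcal A,p)$ with $$q:=\varphi\big(r\mid \beta_0(x,\cdot)\big)\in(q_0,q_1)$$ (a quantity that does not depend on $x$) is transient. Moreover, for every such process and for every $x\in\mathcal S$, $$J_\gamma(x)=\Omega\Big(\frac{1}{1-\gamma}\Big),$$ i.e. there are constants $k,K>0$ and $\varepsilon>0$ (which may depend on $x$ and on the process) such that $\frac{k}{1-\gamma}\le J_\gamma(x)\le \frac{K}{1-\gamma}$ for all $\gamma\in(1-\varepsilon,1)$.
   Context: Notation: $\mathbb Z^2_+=\{(x_1,x_2)\in\mathbb Z^2:x_1,x_2\ge 0\}$, $\mathbb R^2_+=\{(x_1,x_2)\in\mathbb R^2:x_1,x_2\ge0\}$, $|x|=x_1+x_2$ for $x\in\mathbb Z_+^2$, $\langle\cdot,\cdot\rangle$ is the Euclidean inner product, $e_1=(1,0)$, $e_2=(0,1)$. Let $\mathcal P$ be the set of probability measures on $\{e_1,-e_1,e_2,-e_2\}$; for $\mu\in\mathcal P$ its drift is $d(\mu)=(\mu(e_1)-\mu(-e_1),\ \mu(e_2)-\mu(-e_2))\in\mathbb R^2$. Model 1. $\mathcal S=\mathbb Z^2_+$, $\mathcal A=\{r,g\}$, and $p(y\mid x,a)$ is a transition probability function on $\mathcal S$ (probability of moving from $x$ to $y$ when action $a$ is applied) given as follows. For $a\in\{r,g\}$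 there are $\mu_a,\mu_a',\mu_a''\in\mathcal P$ such that, for $i=1,2$, $p(x\pm e_i\mid x,a)$ equals $\mu_a(\pm e_i)$ if $x_1>0,x_2>0$; equals $\mu_a'(\pm e_i)$ if $x_1>0,x_2=0$; equals $\mu_a''(\pm e_i)$ if $x_1=0,x_2>0$. At the origin, $p(e_1\mid(0,0),a)+p(e_2\mid(0,0),a)=1$ for $a=r,g$. Write $d_a=d(\mu_a)$, $d_a'=d(\mu_a')$, $d_a''=d(\mu_a'')$. It is assumed that: (1) there is $v\in\mathbb R^2_+$ with $\langle w,v\rangle<0$ for $w=d_g,d_g',d_g''$; (2) there is a unit vector $l\in\mathbb R^2$ with $\varrho:=\min\{\langle d_r,l\rangle,\langle d_g,l\rangle\}>0$; (3) there exist $0<\alpha_0<\alpha_1\le 1$ such that $\delta d_r+(1-\delta)d_g\in\mathbb R^2_+$ for all $\delta\in(\alpha_0,\alpha_1)$, and $1-\alpha_1<\varrho-\alpha_0$. Local Learning Process (LLP) in $(\mathcal S,\mathcal A,p)$. This is a discrete-time process $(X_n,A_n,\beta_n)_{n\ge0}$ with $X_n\in\mathcal S$, $A_n\in\mathcal A$, $\beta_n:\mathcal S\times\mathcal A\to\mathbb R$ (the environment at time $n$), determined by an initial state $X_0\in\mathcal S$, an initial environment $\beta_0$, a decision rule $\varphi$ (assigning to each function $b:\mathcal A\to\mathbb R$ a probability measure $\varphi(\cdot\mid b)$ on $\mathcal A$) and a real-valued update rule $\psi$, through: (i) given the past, $A_n\sim\varphi(\cdot\mid\beta_n(X_n,\cdot))$;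 (ii) given the past and $A_n$, $X_{n+1}\sim p(\cdot\mid X_n,A_n)$; (iii) $\beta_{n+1}(X_n,A_n)=\psi(\beta_n(X_n,\cdot),\beta_n(X_{n+1},\cdot),X_{n+1}-X_n,A_n)$, and $\beta_{n+1}(x,a)=\beta_n(x,a)$ for $(x,a)\ne(X_n,A_n)$. It is required that $\varphi(a\mid\beta_0(x,\cdot))>0$ for all $x\in\mathcal S,a\in\mathcal A$, and that $\beta_0(x,\cdot)=\beta_0(y,\cdot)$ for all $x,y\in\mathcal S$. The probabilities $\mathbb P(\cdot\mid X_0=x_0)$ refer to the process with the given $\beta_0,\varphi,\psi$ started at $x_0$. Irreducibility and transience. $(X_n)$ is irreducible if for any bounded nonempty $U\subset\mathcal S$ and any $x_0\notin U$, $\mathbb P(\inf\{n\ge1:X_n\in U\}<+\infty\mid X_0=x_0)>0$. It is transient if it is irreducible and for any bounded $U\subset\mathcal S$ there is $x_0\notin U$ with $\mathbb P(\inf\{n\ge1:X_n\in U\}=+\infty\mid X_0=x_0)>0$. Standing assumption: the dynamics considered are irreducible, i.e. the state processes $(X_n)$ of the LLPs in Model 1 are irreducible in this sense. Cost. The one-step cost is $c(x,a,y)=(y_1-x_1)+(y_2-x_2)$ and $J_\gamma(x)=\limsup_{n}\mathbb E\big(\sum_{i=0}^{n-1}\gamma^i c(X_i,A_i,X_{i+1})\mid X_0=x\big)$. *)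

theory Defs
  imports "HOL-Probability.Probability"
begin

type_synonym state = "int \<times> int"

datatype action = Act_r | Act_g

definition quadrant :: "state set" where
  "quadrant = {x. 0 \<le> fst x \<and> 0 \<le> snd x}"

definition real_quadrant :: "(real \<times> real) set" where
  "real_quadrant = {w. 0 \<le> fst w \<and> 0 \<le> snd w}"

definition e1 :: state where "e1 = (1, 0)"
definition e2 :: state where "e2 = (0, 1)"

text \<open>Used for boundedness of sets of states: \<open>int\<close> is not an instance of \<open>metric_space\<close>.\<close>

definition to_plane :: "state \<Rightarrow> real \<times> real" where
  "to_plane x = (of_int (fst x), of_int (snd x))"

definition step_dists :: "state pmf set" where
  "step_dists = {\<mu>. set_pmf \<mu> \<subseteq> {e1, - e1, e2, - e2}}"

definition drift :: "state pmf \<Rightarrow> real \<times> real" where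
  "drift \<mu> = (pmf \<mu> e1 - pmf \<mu> (- e1), pmf \<mu> e2 - pmf \<mu> (- e2))"

text \<open>\<open>p x a\<close> is the law of the next state when action \<open>a\<close> is applied in \<open>x\<close>.
  Only its values for \<open>x \<in> quadrant\<close> matter. As \<open>p x a\<close> lives on the quadrant, the boundary
  clauses force \<open>pmf (\<mu>' a) (- e2) = 0\<close> and \<open>pmf (\<mu>'' a) (- e1) = 0\<close>.\<close>

definition quadrant_transitions ::
  "(state \<Rightarrow> action \<Rightarrow> state pmf) \<Rightarrow> (action \<Rightarrow> state pmf) \<Rightarrow> (action \<Rightarrow> state pmf)
    \<Rightarrow> (action \<Rightarrow> state pmf) \<Rightarrow> bool" where
  "quadrant_transitions p \<mu> \<mu>' \<mu>'' \<longleftrightarrow>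
     (\<forall>x\<in>quadrant. \<forall>a. set_pmf (p x a) \<subseteq> quadrant) \<and>
     (\<forall>a. \<mu> a \<in> step_dists \<and> \<mu>' a \<in> step_dists \<and> \<mu>'' a \<in> step_dists) \<and>
     (\<forall>x a. \<forall>e\<in>{e1, - e1, e2, - e2}.
        (0 < fst x \<and> 0 < snd x \<longrightarrow> pmf (p x a) (x + e) = pmf (\<mu> a) e) \<and>
        (0 < fst x \<and> snd x = 0 \<longrightarrow> pmf (p x a) (x + e) = pmf (\<mu>' a) e) \<and>
        (fst x = 0 \<and> 0 < snd x \<longrightarrow> pmf (p x a) (x + e) = pmf (\<mu>'' a) e)) \<and>
     (\<forall>a. pmf (p (0, 0) a) e1 + pmf (p (0, 0) a) e2 = 1)"

definition model1 :: "(state \<Rightarrow> action \<Rightarrow> state pmf) \<Rightarrow> bool" where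
  "model1 p \<longleftrightarrow>
     (\<exists>\<mu> \<mu>' \<mu>''. quadrant_transitions p \<mu> \<mu>' \<mu>'' \<and>
        (\<exists>v\<in>real_quadrant. \<forall>w\<in>{drift (\<mu> Act_g), drift (\<mu>' Act_g), drift (\<mu>'' Act_g)}.
            w \<bullet> v < 0) \<and>
        (\<exists>l \<rho>. norm l = 1 \<and> \<rho> = min (drift (\<mu> Act_r) \<bullet> l) (drift (\<mu> Act_g) \<bullet> l) \<and> 0 < \<rho> \<and>
           (\<exists>\<alpha>0 \<alpha>1. 0 < \<alpha>0 \<and> \<alpha>0 < \<alpha>1 \<and> \<alpha>1 \<le> 1 \<and>
              (\<forall>\<delta>\<in>{\<alpha>0<..<\<alpha>1}.
                 \<delta> *\<^sub>R drift (\<mu> Act_r) + (1 - \<delta>) *\<^sub>R drift (\<mu> Act_g) \<in> real_quadrant) \<and>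
              1 - \<alpha>1 < \<rho> - \<alpha>0)))"

type_synonym env = "state \<Rightarrow> action \<Rightarrow> real"
type_synonym decision_rule = "(action \<Rightarrow> real) \<Rightarrow> action pmf"
type_synonym update_rule =
  "(action \<Rightarrow> real) \<Rightarrow> (action \<Rightarrow> real) \<Rightarrow> state \<Rightarrow> action \<Rightarrow> real"

definition env_update :: "update_rule \<Rightarrow> env \<Rightarrow> state \<Rightarrow> action \<Rightarrow> state \<Rightarrow> env" where
  "env_update \<psi> b x a y = b(x := (b x)(a := \<psi> (b x) (b y) (y - x) a))"

text \<open>The triples \<open>(X\<^sub>n, A\<^sub>n, \<beta>\<^sub>n)\<close> form a Markov chain, because \<open>X\<^sub>n\<^sub>+\<^sub>1\<close> is drawn from
  \<open>(X\<^sub>n, A\<^sub>n)\<close>, then \<open>\<beta>\<^sub>n\<^sub>+\<^sub>1\<close> is a function of \<open>(X\<^sub>n, A\<^sub>n, \<beta>\<^sub>n, X\<^sub>n\<^sub>+\<^sub>1)\<close>, and \<open>A\<^sub>n\<^sub>+\<^sub>1\<close> is drawn from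
  \<open>(X\<^sub>n\<^sub>+\<^sub>1, \<beta>\<^sub>n\<^sub>+\<^sub>1)\<close>.\<close>

type_synonym config = "state \<times> action \<times> env"

definition llp_init :: "decision_rule \<Rightarrow> env \<Rightarrow> state \<Rightarrow> config pmf" where
  "llp_init \<phi> \<beta>0 x0 = map_pmf (\<lambda>a. (x0, a, \<beta>0)) (\<phi> (\<beta>0 x0))"

definition llp_step ::
  "(state \<Rightarrow> action \<Rightarrow> state pmf) \<Rightarrow> decision_rule \<Rightarrow> update_rule \<Rightarrow> config \<Rightarrow> config pmf" where
  "llp_step p \<phi> \<psi> = (\<lambda>(x, a, b).
     bind_pmf (p x a) (\<lambda>y.
       let b' = env_update \<psi> b x a y in map_pmf (\<lambda>a'. (y, a', b')) (\<phi> (b' y))))"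

text \<open>The argument \<open>\<omega>\<close> of \<open>llp_kernel p \<phi> \<psi> \<beta>0 x0 n \<omega>\<close> is the past \<open>\<omega> 0, \<dots>, \<omega> (n - 1)\<close>.\<close>

definition llp_kernel ::
  "(state \<Rightarrow> action \<Rightarrow> state pmf) \<Rightarrow> decision_rule \<Rightarrow> update_rule \<Rightarrow> env \<Rightarrow> state
    \<Rightarrow> nat \<Rightarrow> (nat \<Rightarrow> config) \<Rightarrow> config measure" where
  "llp_kernel p \<phi> \<psi> \<beta>0 x0 n \<omega> =
     (case n of 0 \<Rightarrow> measure_pmf (llp_init \<phi> \<beta>0 x0)
      | Suc m \<Rightarrow> measure_pmf (llp_step p \<phi> \<psi> (\<omega> m)))"

text \<open>The law of \<open>(X\<^sub>n, A\<^sub>n, \<beta>\<^sub>n)\<^sub>n\<close> started at \<open>x0\<close>, on the space of trajectories: the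
  Ionescu--Tulcea extension of \<open>llp_kernel\<close>. Its cylinder probabilities are computed in
  \<open>emeasure_llp_law_cylinder\<close> below.\<close>

definition llp_law ::
  "(state \<Rightarrow> action \<Rightarrow> state pmf) \<Rightarrow> decision_rule \<Rightarrow> update_rule \<Rightarrow> env \<Rightarrow> state
    \<Rightarrow> (nat \<Rightarrow> config) measure" where
  "llp_law p \<phi> \<psi> \<beta>0 x0 =
     projective_family.lim UNIV
       (Ionescu_Tulcea.CI (llp_kernel p \<phi> \<psi> \<beta>0 x0) (\<lambda>_. count_space UNIV))
       (\<lambda>_. count_space UNIV)"

definition llp_X :: "nat \<Rightarrow> (nat \<Rightarrow> config) \<Rightarrow> state" where
  "llp_X n \<omega> = fst (\<omega> n)"

definition llp_A :: "nat \<Rightarrow> (nat \<Rightarrow> config) \<Rightarrow> action" where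
  "llp_A n \<omega> = fst (snd (\<omega> n))"

definition admissible_llp :: "decision_rule \<Rightarrow> env \<Rightarrow> bool" where
  "admissible_llp \<phi> \<beta>0 \<longleftrightarrow>
     (\<forall>x\<in>quadrant. \<forall>a. 0 < pmf (\<phi> (\<beta>0 x)) a) \<and>
     (\<forall>x\<in>quadrant. \<forall>y\<in>quadrant. \<beta>0 x = \<beta>0 y)"

definition return_time :: "state set \<Rightarrow> (nat \<Rightarrow> config) \<Rightarrow> enat" where
  "return_time U \<omega> = (INF n\<in>{n. 1 \<le> n \<and> llp_X n \<omega> \<in> U}. enat n)"

definition llp_irreducible ::
  "(state \<Rightarrow> action \<Rightarrow> state pmf) \<Rightarrow> decision_rule \<Rightarrow> update_rule \<Rightarrow> env \<Rightarrow> bool" where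
  "llp_irreducible p \<phi> \<psi> \<beta>0 \<longleftrightarrow>
     (\<forall>U. U \<subseteq> quadrant \<and> bounded (to_plane ` U) \<and> U \<noteq> {} \<longrightarrow>
        (\<forall>x0\<in>quadrant - U. 0 < \<P>(\<omega> in llp_law p \<phi> \<psi> \<beta>0 x0. return_time U \<omega> < \<infinity>)))"

definition llp_transient ::
  "(state \<Rightarrow> action \<Rightarrow> state pmf) \<Rightarrow> decision_rule \<Rightarrow> update_rule \<Rightarrow> env \<Rightarrow> bool" where
  "llp_transient p \<phi> \<psi> \<beta>0 \<longleftrightarrow>
     llp_irreducible p \<phi> \<psi> \<beta>0 \<and>
     (\<forall>U. U \<subseteq> quadrant \<and> bounded (to_plane ` U) \<longrightarrow>
        (\<exists>x0\<in>quadrant - U. 0 < \<P>(\<omega> in llp_law p \<phi> \<psi> \<beta>0 x0. return_time U \<omega> = \<infinity>)))"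

definition cost :: "state \<Rightarrow> action \<Rightarrow> state \<Rightarrow> real" where
  "cost x a y = of_int ((fst y - fst x) + (snd y - snd x))"

definition llp_J ::
  "(state \<Rightarrow> action \<Rightarrow> state pmf) \<Rightarrow> decision_rule \<Rightarrow> update_rule \<Rightarrow> env
    \<Rightarrow> real \<Rightarrow> state \<Rightarrow> ereal" where
  "llp_J p \<phi> \<psi> \<beta>0 \<gamma> x =
     limsup (\<lambda>n. ereal (\<integral>\<omega>. (\<Sum>i<n. \<gamma> ^ i * cost (llp_X i \<omega>) (llp_A i \<omega>) (llp_X (Suc i) \<omega>))
       \<partial>llp_law p \<phi> \<psi> \<beta>0 x))"

interpretation LLP: Ionescu_Tulcea "llp_kernel p \<phi> \<psi> \<beta>0 x0" "\<lambda>_. count_space UNIV"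
  for p \<phi> \<psi> \<beta>0 x0
proof (rule Ionescu_Tulcea.intro)
  fix i :: nat
  show "llp_kernel p \<phi> \<psi> \<beta>0 x0 i \<in>
      measurable (PiM {0..<i} (\<lambda>_. count_space UNIV)) (subprob_algebra (count_space UNIV))"
  proof (cases i)
    case 0
    then show ?thesis
      by (simp add: llp_kernel_def[abs_def] space_subprob_algebra measure_pmf.subprob_space_axioms)
  next
    case (Suc m)
    have "(\<lambda>\<omega>. \<omega> m) \<in> measurable (PiM {0..<i} (\<lambda>_. count_space UNIV)) (count_space UNIV)"
      using Suc by (intro measurable_component_singleton) auto
    moreover have "(\<lambda>s. measure_pmf (llp_step p \<phi> \<psi> s)) \<in>
        measurable (count_space UNIV) (subprob_algebra (count_space UNIV))"
      by (auto simp: space_subprob_algebra measure_pmf.subprob_space_axioms)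
    ultimately show ?thesis
      using Suc by (simp add: llp_kernel_def[abs_def] measurable_compose)
  qed
next
  fix i :: nat and x :: "nat \<Rightarrow> config"
  show "prob_space (llp_kernel p \<phi> \<psi> \<beta>0 x0 i x)"
    by (cases i) (simp_all add: llp_kernel_def measure_pmf.prob_space_axioms)
qed

lemma llp_law_eq_lim: "llp_law p \<phi> \<psi> \<beta>0 x0 = LLP.PF.lim p \<phi> \<psi> \<beta>0 x0"
  by (simp add: llp_law_def)

lemma sets_llp_law:
  "sets (llp_law p \<phi> \<psi> \<beta>0 x0) = sets (PiM UNIV (\<lambda>_. count_space UNIV))"
  by (simp add: llp_law_eq_lim)

lemma space_llp_law: "space (llp_law p \<phi> \<psi> \<beta>0 x0) = UNIV"
  using sets_eq_imp_space_eq[OF sets_llp_law] by (simp add: space_PiM)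

lemma prob_space_llp_law: "prob_space (llp_law p \<phi> \<psi> \<beta>0 x0)"
proof
  have "emeasure (llp_law p \<phi> \<psi> \<beta>0 x0) (LLP.PF.emb UNIV {} {\<lambda>_. undefined}) =
      emeasure (LLP.CI p \<phi> \<psi> \<beta>0 x0 {}) {\<lambda>_. undefined}"
    unfolding llp_law_eq_lim by (rule LLP.lim) (auto simp: sets_PiM_empty)
  also have "\<dots> = 1"
    using prob_space.emeasure_space_1[OF LLP.PF.prob_space_P[of "{}" p \<phi> \<psi> \<beta>0 x0]]
    by (simp add: LLP.PF.space_P space_PiM)
  finally show "emeasure (llp_law p \<phi> \<psi> \<beta>0 x0) (space (llp_law p \<phi> \<psi> \<beta>0 x0)) = 1"
    by (simp add: space_llp_law prod_emb_def space_PiM restrict_def)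
qed

lemma cylinder_in_sets:
  "{restrict s {0..<n}} \<in> sets (PiM {0..<n :: nat} (\<lambda>_. count_space UNIV))"
proof -
  have "{restrict s {0..<n}} = (\<Pi>\<^sub>E i\<in>{0..<n}. {s i})"
    by (auto simp: PiE_iff extensional_def fun_eq_iff restrict_def)
  then show ?thesis
    by (simp add: sets_PiM_I_finite)
qed

lemma emeasure_C_cylinder:
  "emeasure (LLP.C p \<phi> \<psi> \<beta>0 x0 0 n (\<lambda>_. undefined)) {restrict s {0..<n}} =
     (\<Prod>i<n. emeasure (llp_kernel p \<phi> \<psi> \<beta>0 x0 i s) {s i})"
proof (induction n)
  case 0
  show ?case by (simp add: restrict_def PiM_empty)
next
  case (Suc n)
  let ?C = "LLP.C p \<phi> \<psi> \<beta>0 x0 0 n (\<lambda>_. undefined)"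
  let ?M = "\<lambda>n. PiM {0..<n :: nat} (\<lambda>_. count_space (UNIV :: config set))"
  let ?k = "emeasure (llp_kernel p \<phi> \<psi> \<beta>0 x0 n s) {s n}"
  have u: "(\<lambda>_. undefined) \<in> space (?M 0)"
    by (simp add: space_PiM)
  have spC: "space ?C = space (?M n)" and setC: "sets ?C = sets (?M n)"
    using LLP.space_C[OF u, of p \<phi> \<psi> \<beta>0 x0 n] LLP.sets_C[OF u, of p \<phi> \<psi> \<beta>0 x0 n] by simp_all
  have eP: "emeasure (LLP.eP p \<phi> \<psi> \<beta>0 x0 n \<omega>) {restrict s {0..<Suc n}} =
      ?k * indicator {restrict s {0..<n}} \<omega>" if \<omega>: "\<omega> \<in> space ?C" for \<omega>
  proof -
    have \<omega>': "\<omega> \<in> space (?M n)" using \<omega> spC by simp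
    then have ext: "\<omega> \<in> extensional {0..<n}" by (simp add: space_PiM PiE_iff)
    have vim: "fun_upd \<omega> n -` {restrict s {0..<Suc n}} =
        (if \<omega> = restrict s {0..<n} then {s n} else {})"
    proof -
      have "fun_upd \<omega> n z = restrict s {0..<Suc n} \<longleftrightarrow> \<omega> = restrict s {0..<n} \<and> z = s n" for z
      proof
        assume eq: "fun_upd \<omega> n z = restrict s {0..<Suc n}"
        have "z = s n" using fun_cong[OF eq, of n] by simp
        moreover have "\<omega> i = restrict s {0..<n} i" for i
          using fun_cong[OF eq, of i] ext
          by (cases "i = n") (auto simp: extensional_def restrict_def split: if_splits)
        ultimately show "\<omega> = restrict s {0..<n} \<and> z = s n" by auto
      next
        assume "\<omega> = restrict s {0..<n} \<and> z = s n"
        then show "fun_upd \<omega> n z = restrict s {0..<Suc n}"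
          by (auto simp: fun_eq_iff restrict_def)
      qed
      then show ?thesis
        unfolding vimage_def by simp
    qed
    have ker: "llp_kernel p \<phi> \<psi> \<beta>0 x0 n (restrict s {0..<n}) = llp_kernel p \<phi> \<psi> \<beta>0 x0 n s"
      by (cases n) (simp_all add: llp_kernel_def)
    show ?thesis
      using LLP.emeasure_eP[OF \<omega>' cylinder_in_sets[of s "Suc n"], of p \<phi> \<psi> \<beta>0 x0] vim ker by auto
  qed
  have "emeasure (LLP.C p \<phi> \<psi> \<beta>0 x0 0 (Suc n) (\<lambda>_. undefined)) {restrict s {0..<Suc n}} =
      (\<integral>\<^sup>+\<omega>. emeasure (LLP.eP p \<phi> \<psi> \<beta>0 x0 n \<omega>) {restrict s {0..<Suc n}} \<partial>?C)"
  proof -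
    have "LLP.eP p \<phi> \<psi> \<beta>0 x0 n \<in> measurable ?C (subprob_algebra (?M (Suc n)))"
      using LLP.measurable_eP[of p \<phi> \<psi> \<beta>0 x0 n] measurable_cong_sets[OF setC refl] by blast
    moreover have "space ?C \<noteq> {}"
      using prob_space.not_empty[OF LLP.prob_space_C[OF u]] .
    ultimately show ?thesis
      using emeasure_bind[of ?C _ "?M (Suc n)"] cylinder_in_sets[of s "Suc n"] by simp
  qed
  also have "\<dots> = (\<integral>\<^sup>+\<omega>. ?k * indicator {restrict s {0..<n}} \<omega> \<partial>?C)"
    by (intro nn_integral_cong eP)
  also have "\<dots> = ?k * emeasure ?C {restrict s {0..<n}}"
    using cylinder_in_sets[of s n] setC by (intro nn_integral_cmult_indicator) simp
  finally show ?case
    unfolding Suc.IH prod.lessThan_Suc by (simp only: mult.commute)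
qed

lemma emeasure_llp_law_cylinder:
  "emeasure (llp_law p \<phi> \<psi> \<beta>0 x0) {\<omega>. \<forall>i\<le>n. \<omega> i = s i} =
     ennreal (pmf (llp_init \<phi> \<beta>0 x0) (s 0) * (\<Prod>i<n. pmf (llp_step p \<phi> \<psi> (s i)) (s (Suc i))))"
proof -
  let ?I = "{0..<Suc n}"
  have cyl: "{restrict s ?I} \<in> sets (PiM ?I (\<lambda>_. count_space UNIV))"
    by (rule cylinder_in_sets)
  have emb: "LLP.PF.emb UNIV ?I {restrict s ?I} = {\<omega>. \<forall>i\<le>n. \<omega> i = s i}"
  proof -
    have "restrict \<omega> ?I = restrict s ?I \<longleftrightarrow> (\<forall>i\<le>n. \<omega> i = s i)" for \<omega>
      by (auto simp: fun_eq_iff restrict_def less_Suc_eq_le)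
    then show ?thesis by (auto simp: prod_emb_def space_PiM)
  qed
  have id: "LLP.PF.emb ?I ?I {restrict s ?I} = {restrict s ?I}"
    by (rule prod_emb_id) (auto simp: PiE_iff)
  have "emeasure (llp_law p \<phi> \<psi> \<beta>0 x0) {\<omega>. \<forall>i\<le>n. \<omega> i = s i} =
      emeasure (LLP.CI p \<phi> \<psi> \<beta>0 x0 ?I) {restrict s ?I}"
    using LLP.lim[OF _ cyl, of p \<phi> \<psi> \<beta>0 x0] emb by (simp add: llp_law_eq_lim)
  also have "\<dots> = emeasure (LLP.C p \<phi> \<psi> \<beta>0 x0 0 (Suc n) (\<lambda>_. undefined)) {restrict s ?I}"
    using LLP.emeasure_CI[OF order_refl cyl, of p \<phi> \<psi> \<beta>0 x0] id by simp
  also have "\<dots> = (\<Prod>i<Suc n. emeasure (llp_kernel p \<phi> \<psi> \<beta>0 x0 i s) {s i})"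
    by (rule emeasure_C_cylinder)
  also have "\<dots> = ennreal (pmf (llp_init \<phi> \<beta>0 x0) (s 0) *
      (\<Prod>i<n. pmf (llp_step p \<phi> \<psi> (s i)) (s (Suc i))))"
    by (simp add: prod.lessThan_Suc_shift llp_kernel_def emeasure_pmf_single prod_ennreal
        ennreal_mult prod_nonneg del: prod.lessThan_Suc)
  finally show ?thesis .
qed

end

theory Submission
  imports Defs
begin

text \<open>The only uncontrolled choices of the walk are those made on revisits: on the first visit to a site
the action is \<open>r\<close> with probability \<open>q\<close>, later it depends on an arbitrary update rule. Revisits are
limited by the direction \<open>l\<close>. As long as the walk stays off the axes, both actions push it along \<open>l\<close>
with speed at least \<open>\<rho>\<close>, and one step gains at most \<open>1\<close> along \<open>l\<close>; so a fraction of at least \<open>\<rho>\<close> of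
the steps leaves from sites that were never visited before. The overall frequency of \<open>r\<close> is thus
between \<open>q\<rho>\<close> and \<open>q\<rho> + 1 - \<rho>\<close>. Both bounds lie in \<open>(\<alpha>0, \<alpha>1)\<close> exactly when
\<open>\<alpha>0 / \<rho> < q < (\<alpha>1 - 1 + \<rho>) / \<rho>\<close>, which is the interval \<open>(q0, q1)\<close> used below; it is nonempty by
\<open>1 - \<alpha>1 < \<rho> - \<alpha>0\<close>. For frequencies in \<open>(\<alpha>0, \<alpha>1)\<close> the mean drift points strictly into the quadrant,
and the walk should run away from both axes with positive speed.

This frequency count becomes a supermartingale argument as follows. For a coordinate direction \<open>e\<close> put
\<open>W\<^sub>e = \<langle>X, e + \<beta>\<^sub>e l\<rangle> - \<beta>\<^sub>e D\<close>, where \<open>D\<close> is the number of interior sites left so far.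
The visited interior sites form a path-connected set, so their number dominates the displacement along
\<open>l\<close> (\<open>line_bound_step\<close>), and \<open>W\<^sub>e\<close> is a lower bound for the coordinate of \<open>X\<close> along \<open>e\<close>, up to a
constant. For a suitable weight \<open>\<beta>\<^sub>e\<close> the drift of \<open>W\<^sub>e\<close> is at least some \<open>\<eta> > 0\<close> both at fresh
and at revisited interior sites, whatever the update rule does there (\<open>exists_compensator\<close>,
\<open>expected_potential_gain\<close>). Hence \<open>exp (- \<theta> (W\<^sub>e - c n))\<close> is a supermartingale for some \<open>\<theta> > 0\<close> and
\<open>c = \<eta> / 2\<close>, and once both potentials are large the walk stays with probability close to \<open>1\<close> in a
region that recedes linearly from the axes (\<open>prob_follows_ge\<close>). The potentials can be made large:
a monotone staircase in the direction of the drift at fresh sites visits fresh sites only, has positive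
probability, and increases \<open>W\<^sub>e\<close> by \<open>\<eta>\<close> per step on average (\<open>escape_probability\<close>).

Transience follows by starting beyond the given bounded set (\<open>avoids_bounded_set\<close>). For the
cost, irreducibility brings the walk from any state into the interior, having visited only axis sites
before (\<open>interior_entrance\<close>), so that it escapes with positive probability and \<open>E\<bar>X\<^sub>n\<bar>\<close> is at least
\<open>a n - B\<close> (\<open>mean_size_linear\<close>). A summation by parts turns this into the lower bound for the
discounted cost (\<open>discounted_increments_order\<close>); the upper bound holds because a step changes \<open>\<bar>X\<bar>\<close> by
at most \<open>1\<close>.\<close>

section \<open>Preliminaries on probability mass functions\<close>

lemma UNIV_action: "(UNIV :: action set) = {Act_r, Act_g}"
  using action.exhaust by auto

instance action :: finite
  by standard (simp add: UNIV_action)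

lemma expectation_action:
  fixes f :: "action \<Rightarrow> real"
  shows "measure_pmf.expectation M f = pmf M Act_r * f Act_r + pmf M Act_g * f Act_g"
  proof -
  have "measure_pmf.expectation M f = (\<Sum>a\<in>UNIV. pmf M a *\<^sub>R f a)"
    by (intro integral_measure_pmf) auto
  then show ?thesis by (simp add: UNIV_action)
qed

lemma pmf_Act_g: "pmf M Act_g = 1 - pmf M Act_r"
  using expectation_action[of M "\<lambda>_. 1"] by simp

lemma set_pmf_subset_if_sum_pmf_eq_1:
  assumes "finite A" "(\<Sum>x\<in>A. pmf M x) = 1"
  shows "set_pmf M \<subseteq> A"
proof -
  have "measure_pmf.prob M A = 1"
    using assms by (simp add: measure_measure_pmf_finite)
  then show ?thesis by (auto simp: measure_pmf.prob_eq_1 AE_measure_pmf_iff)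
qed

lemma prob_bind_pmf:
  "measure_pmf.prob (bind_pmf M f) A = measure_pmf.expectation M (\<lambda>x. measure_pmf.prob (f x) A)"
proof -
  have "ennreal (measure_pmf.prob (bind_pmf M f) A) =
      (\<integral>\<^sup>+x. ennreal (measure_pmf.prob (f x) A) \<partial>measure_pmf M)"
    by (simp flip: measure_pmf.emeasure_eq_measure)
  also have "\<dots> = ennreal (measure_pmf.expectation M (\<lambda>x. measure_pmf.prob (f x) A))"
    by (intro nn_integral_eq_integral measure_pmf.integrable_const_bound[where B=1]) auto
  finally show ?thesis by (simp add: integral_nonneg_AE)
qed

lemma prob_bind_pmf_ge: "pmf M x * measure_pmf.prob (f x) A \<le> measure_pmf.prob (bind_pmf M f) A"
proof -
  have "pmf M x * measure_pmf.prob (f x) A =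
      measure_pmf.expectation M (\<lambda>y. measure_pmf.prob (f x) A * indicator {x} y)"
    by (simp add: measure_pmf_single)
  also have "\<dots> \<le> measure_pmf.expectation M (\<lambda>y. measure_pmf.prob (f y) A)"
    by (intro integral_mono measure_pmf.integrable_const_bound[where B=1])
      (auto simp: indicator_def)
  finally show ?thesis by (simp add: prob_bind_pmf)
qed

section \<open>Trajectories as lists\<close>

text \<open>Histories are finite lists, newest entry first, so that their laws are discrete and can be computed
by binding; infinite trajectories enter only through \<open>trace_le_law\<close>.\<close>

primrec config_history ::
  "(state \<Rightarrow> action \<Rightarrow> state pmf) \<Rightarrow> decision_rule \<Rightarrow> update_rule \<Rightarrow> env \<Rightarrow> state
    \<Rightarrow> nat \<Rightarrow> config list pmf" where
  "config_history p \<phi> \<psi> \<beta>0 x0 0 = map_pmf (\<lambda>c. [c]) (llp_init \<phi> \<beta>0 x0)"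
| "config_history p \<phi> \<psi> \<beta>0 x0 (Suc n) =
     bind_pmf (config_history p \<phi> \<psi> \<beta>0 x0 n)
       (\<lambda>h. map_pmf (\<lambda>c. c # h) (llp_step p \<phi> \<psi> (hd h)))"

lemma length_config_history:
  "h \<in> set_pmf (config_history p \<phi> \<psi> \<beta>0 x0 n) \<Longrightarrow> length h = Suc n"
  by (induction n arbitrary: h) auto

lemma pmf_map_Cons: "pmf (map_pmf (\<lambda>c. c # h) M) (c # h') = (if h' = h then pmf M c else 0)"
proof (cases "h' = h")
  case True
  then show ?thesis using pmf_map_inj'[of "\<lambda>c. c # h" M c] by (simp add: inj_def)
next
  case False
  then show ?thesis by (auto simp: pmf_eq_0_set_pmf)
qed

lemma pmf_config_history_Suc:
  "pmf (config_history p \<phi> \<psi> \<beta>0 x0 (Suc n)) (c # h) =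
     pmf (config_history p \<phi> \<psi> \<beta>0 x0 n) h * pmf (llp_step p \<phi> \<psi> (hd h)) c"
proof -
  let ?M = "config_history p \<phi> \<psi> \<beta>0 x0 n"
  have "pmf (config_history p \<phi> \<psi> \<beta>0 x0 (Suc n)) (c # h) =
      (\<integral>h'. pmf (llp_step p \<phi> \<psi> (hd h)) c * indicator {h} h' \<partial>measure_pmf ?M)"
    unfolding config_history.simps pmf_bind pmf_map_Cons
    by (intro Bochner_Integration.integral_cong) (auto simp: indicator_def)
  also have "\<dots> = pmf (llp_step p \<phi> \<psi> (hd h)) c * pmf ?M h"
    by (simp add: measure_pmf_single)
  finally show ?thesis by simp
qed

lemma emeasure_history_cylinder:
  "emeasure (llp_law p \<phi> \<psi> \<beta>0 x0) {\<omega>. map \<omega> (rev [0..<Suc n]) = map s (rev [0..<Suc n])} =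
     ennreal (pmf (config_history p \<phi> \<psi> \<beta>0 x0 n) (map s (rev [0..<Suc n])))"
proof -
  have 1: "pmf (config_history p \<phi> \<psi> \<beta>0 x0 n) (map s (rev [0..<Suc n])) =
      pmf (llp_init \<phi> \<beta>0 x0) (s 0) * (\<Prod>i<n. pmf (llp_step p \<phi> \<psi> (s i)) (s (Suc i)))"
  proof (induction n)
    case 0
    have "pmf (map_pmf (\<lambda>c. [c]) (llp_init \<phi> \<beta>0 x0)) [s 0] = pmf (llp_init \<phi> \<beta>0 x0) (s 0)"
      using pmf_map_inj'[of "\<lambda>c. [c]"] by (simp add: inj_def)
    then show ?case by simp
  next
    case (Suc n)
    have "map s (rev [0..<Suc (Suc n)]) = s (Suc n) # map s (rev [0..<Suc n])"
      by simp
    then show ?case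
      unfolding pmf_config_history_Suc Suc.IH
      by (simp only: pmf_config_history_Suc Suc.IH) simp
  qed
  have "{\<omega>. map \<omega> (rev [0..<Suc n]) = map s (rev [0..<Suc n])} = {\<omega>. \<forall>i\<le>n. \<omega> i = s i}"
    by (auto simp: less_Suc_eq_le)
  then show ?thesis
    unfolding 1 using emeasure_llp_law_cylinder[of p \<phi> \<psi> \<beta>0 x0 n s] by simp
qed

text \<open>The \<open>\<sigma>\<close>-algebra of the trajectory space need not make the map from trajectories to histories
measurable for all sets of histories, since there are uncountably many configurations. Only countably
many histories have positive probability, and the union of their cylinders is measurable; this yields an
inequality between probabilities, which suffices throughout.\<close>

lemma config_history_le_law:
  assumes E: "E \<in> sets (llp_law p \<phi> \<psi> \<beta>0 x0)"
    and Q: "\<And>\<omega>. map \<omega> (rev [0..<Suc n]) \<in> Q \<Longrightarrow> \<omega> \<in> E"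
  shows "measure_pmf.prob (config_history p \<phi> \<psi> \<beta>0 x0 n) Q \<le> measure (llp_law p \<phi> \<psi> \<beta>0 x0) E"
proof -
  interpret L: prob_space "llp_law p \<phi> \<psi> \<beta>0 x0" by (rule prob_space_llp_law)
  let ?M = "config_history p \<phi> \<psi> \<beta>0 x0 n"
  let ?L = "llp_law p \<phi> \<psi> \<beta>0 x0"
  let ?Q = "Q \<inter> set_pmf ?M"
  let ?cyl = "\<lambda>h. {\<omega>. map \<omega> (rev [0..<Suc n]) = h}"
  have cnt: "countable ?Q" by auto
  have repr: "\<exists>s. h = map s (rev [0..<Suc n])" if "h \<in> ?Q" for h
  proof -
    have "length h = Suc n"
      using length_config_history[of h p \<phi> \<psi> \<beta>0 x0 n] that by blast
    then have "h = map (\<lambda>i. h ! (n - i)) (rev [0..<Suc n])"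
      by (intro nth_equalityI) (auto simp: rev_nth simp del: upt_Suc)
    then show ?thesis by blast
  qed
  have em: "emeasure ?L (?cyl h) = ennreal (pmf ?M h)" if "h \<in> ?Q" for h
    using repr[OF that] emeasure_history_cylinder by blast
  have meas: "?cyl h \<in> sets ?L" if "h \<in> ?Q" for h
  proof -
    have "pmf ?M h > 0" using that by (simp add: pmf_positive)
    then have "emeasure ?L (?cyl h) \<noteq> 0" using em[OF that] by simp
    then show ?thesis using emeasure_notin_sets by blast
  qed
  have "emeasure ?M Q = (\<integral>\<^sup>+h. emeasure ?L (?cyl h) \<partial>count_space ?Q)"
  proof -
    have "emeasure ?M Q = emeasure ?M ?Q"
      by (simp add: emeasure_Int_set_pmf)
    also have "\<dots> = (\<integral>\<^sup>+h. pmf ?M h \<partial>count_space ?Q)"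
      by (simp add: nn_integral_pmf)
    also have "\<dots> = (\<integral>\<^sup>+h. emeasure ?L (?cyl h) \<partial>count_space ?Q)"
      by (intro nn_integral_cong) (simp only: em space_count_space)
    finally show ?thesis .
  qed
  also have "\<dots> = emeasure ?L (\<Union>h\<in>?Q. ?cyl h)"
    using cnt meas by (intro emeasure_UN_countable[symmetric]) (auto simp: disjoint_family_on_def)
  also have "\<dots> \<le> emeasure ?L E"
    using E Q by (intro emeasure_mono) auto
  finally show ?thesis
    by (simp add: measure_pmf.emeasure_eq_measure L.emeasure_eq_measure)
qed

type_synonym trace = "state list \<times> env"

text \<open>A trace records the sites visited and the present environment just before the next action is drawn.
Conditioning at this moment is what makes the probability \<open>q\<close> of action \<open>r\<close> at a fresh site visible:
a configuration already contains the drawn action.\<close>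

definition trace_step ::
  "(state \<Rightarrow> action \<Rightarrow> state pmf) \<Rightarrow> decision_rule \<Rightarrow> update_rule \<Rightarrow> trace \<Rightarrow> trace pmf" where
  "trace_step p \<phi> \<psi> = (\<lambda>(xs, b).
     bind_pmf (\<phi> (b (hd xs))) (\<lambda>a.
       map_pmf (\<lambda>y. (y # xs, env_update \<psi> b (hd xs) a y)) (p (hd xs) a)))"

text \<open>The recursion splits off the first step, which suits the backward induction in
\<open>prob_follows_ge\<close>; \<open>trace_after_Suc_right\<close> splits off the last one.\<close>

primrec trace_after ::
  "(state \<Rightarrow> action \<Rightarrow> state pmf) \<Rightarrow> decision_rule \<Rightarrow> update_rule \<Rightarrow> nat \<Rightarrow> trace \<Rightarrow> trace pmf"
where
  "trace_after p \<phi> \<psi> 0 s = return_pmf s"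
| "trace_after p \<phi> \<psi> (Suc n) s = bind_pmf (trace_step p \<phi> \<psi> s) (trace_after p \<phi> \<psi> n)"

lemma trace_after_add:
  "trace_after p \<phi> \<psi> (m + n) s = bind_pmf (trace_after p \<phi> \<psi> m s) (trace_after p \<phi> \<psi> n)"
proof (induction m arbitrary: s)
  case 0
  show ?case by (simp add: bind_return_pmf)
next
  case (Suc m)
  have "trace_after p \<phi> \<psi> (m + n) =
      (\<lambda>s. bind_pmf (trace_after p \<phi> \<psi> m s) (trace_after p \<phi> \<psi> n))"
    using Suc by blast
  then show ?case by (simp add: bind_assoc_pmf)
qed

lemma trace_after_Suc_right:
  "trace_after p \<phi> \<psi> (Suc n) s = bind_pmf (trace_after p \<phi> \<psi> n s) (trace_step p \<phi> \<psi>)"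
proof -
  have "trace_after p \<phi> \<psi> 1 = trace_step p \<phi> \<psi>"
  proof -
    have "trace_after p \<phi> \<psi> 0 = return_pmf"
      by (rule ext) simp
    then show ?thesis by (intro ext) (simp add: bind_return_pmf')
  qed
  then show ?thesis using trace_after_add[of p \<phi> \<psi> n 1 s] by simp
qed

lemma config_history_as_trace:
  "map_pmf (\<lambda>h. (map fst h, snd (snd (hd h)), fst (snd (hd h)))) (config_history p \<phi> \<psi> \<beta>0 x0 n) =
     bind_pmf (trace_after p \<phi> \<psi> n ([x0], \<beta>0))
       (\<lambda>(xs, b). map_pmf (\<lambda>a. (xs, b, a)) (\<phi> (b (hd xs))))"
proof (induction n)
  case 0
  show ?case by (simp add: llp_init_def bind_return_pmf map_pmf_comp)
next
  case (Suc n)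
  let ?M = "config_history p \<phi> \<psi> \<beta>0 x0 n"
  define k where "k = (\<lambda>(xs :: state list, b :: env, a).
     bind_pmf (p (hd xs) a) (\<lambda>y. map_pmf (\<lambda>a'. (y # xs, env_update \<psi> b (hd xs) a y, a'))
        (\<phi> (env_update \<psi> b (hd xs) a y y))))"
  have "map_pmf (\<lambda>h. (map fst h, snd (snd (hd h)), fst (snd (hd h)))) (config_history p \<phi> \<psi> \<beta>0 x0 (Suc n))
     = bind_pmf ?M (\<lambda>h. k (map fst h, snd (snd (hd h)), fst (snd (hd h))))"
    unfolding config_history.simps map_bind_pmf
  proof (intro bind_pmf_cong refl)
    fix h assume "h \<in> set_pmf ?M"
    then have "h \<noteq> []" using length_config_history[of h p \<phi> \<psi> \<beta>0 x0 n] by auto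
    then show "map_pmf (\<lambda>h. (map fst h, snd (snd (hd h)), fst (snd (hd h))))
          (map_pmf (\<lambda>c. c # h) (llp_step p \<phi> \<psi> (hd h))) =
        k (map fst h, snd (snd (hd h)), fst (snd (hd h)))"
      by (cases "hd h") (simp add: k_def llp_step_def map_pmf_comp map_bind_pmf Let_def hd_map)
  qed
  also have "\<dots> = bind_pmf (map_pmf (\<lambda>h. (map fst h, snd (snd (hd h)), fst (snd (hd h)))) ?M) k"
    by (simp add: bind_map_pmf)
  also have "\<dots> = bind_pmf (trace_after p \<phi> \<psi> n ([x0], \<beta>0))
      (\<lambda>(xs, b). bind_pmf (\<phi> (b (hd xs))) (\<lambda>a. k (xs, b, a)))"
    unfolding Suc.IH by (simp add: bind_assoc_pmf bind_map_pmf case_prod_unfold)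
  also have "\<dots> = bind_pmf (trace_after p \<phi> \<psi> (Suc n) ([x0], \<beta>0))
      (\<lambda>(xs, b). map_pmf (\<lambda>a. (xs, b, a)) (\<phi> (b (hd xs))))"
    unfolding trace_after_Suc_right
    by (simp add: bind_assoc_pmf bind_map_pmf case_prod_unfold trace_step_def k_def)
  finally show ?case .
qed

lemma trace_le_law:
  assumes E: "E \<in> sets (llp_law p \<phi> \<psi> \<beta>0 x0)"
    and Q: "\<And>\<omega>. Q (map (\<lambda>i. llp_X i \<omega>) (rev [0..<Suc n])) \<Longrightarrow> \<omega> \<in> E"
  shows "measure_pmf.prob (trace_after p \<phi> \<psi> n ([x0], \<beta>0)) {s. Q (fst s)}
           \<le> measure (llp_law p \<phi> \<psi> \<beta>0 x0) E"
proof -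
  let ?g = "\<lambda>h :: config list. (map fst h, snd (snd (hd h)), fst (snd (hd h)))"
  have "map_pmf fst (trace_after p \<phi> \<psi> n ([x0], \<beta>0)) =
      map_pmf fst (map_pmf ?g (config_history p \<phi> \<psi> \<beta>0 x0 n))"
    unfolding config_history_as_trace
    by (simp add: map_bind_pmf map_pmf_comp case_prod_unfold) (simp add: map_pmf_def)
  then have eq: "map_pmf fst (trace_after p \<phi> \<psi> n ([x0], \<beta>0)) =
      map_pmf (map fst) (config_history p \<phi> \<psi> \<beta>0 x0 n)"
    by (simp add: map_pmf_comp)
  have "measure_pmf.prob (trace_after p \<phi> \<psi> n ([x0], \<beta>0)) {s. Q (fst s)} =
      measure_pmf.prob (map_pmf fst (trace_after p \<phi> \<psi> n ([x0], \<beta>0))) {xs. Q xs}"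
    by (simp add: vimage_def)
  also have "\<dots> = measure_pmf.prob (config_history p \<phi> \<psi> \<beta>0 x0 n) {h. Q (map fst h)}"
    unfolding eq by (simp add: vimage_def)
  also have "\<dots> \<le> measure (llp_law p \<phi> \<psi> \<beta>0 x0) E"
    using E Q by (intro config_history_le_law) (auto simp: llp_X_def comp_def simp del: upt_Suc)
  finally show ?thesis .
qed

section \<open>Mean drifts and their compensation\<close>

text \<open>An affine function that vanishes inside an interval on which it is nonnegative has slope zero, so it
vanishes identically.\<close>

lemma affine_pos_if_nonneg_around:
  fixes a b :: real
  assumes nonneg: "\<And>\<delta>. \<delta> \<in> {\<alpha>0<..<\<alpha>1} \<Longrightarrow> 0 \<le> \<delta> * a + (1 - \<delta>) * b"
    and ne: "\<not> (a = 0 \<and> b = 0)" and \<delta>: "\<delta> \<in> {\<alpha>0<..<\<alpha>1}"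
  shows "0 < \<delta> * a + (1 - \<delta>) * b"
proof (rule ccontr)
  assume "\<not> ?thesis"
  with nonneg[OF \<delta>] have zero: "\<delta> * a + (1 - \<delta>) * b = 0" by simp
  define h where "h = min (\<delta> - \<alpha>0) (\<alpha>1 - \<delta>) / 2"
  have h: "0 < h" "\<delta> + h \<in> {\<alpha>0<..<\<alpha>1}" "\<delta> - h \<in> {\<alpha>0<..<\<alpha>1}"
    using \<delta> by (auto simp: h_def min_def field_simps)
  have "0 \<le> h * (a - b)" "0 \<le> h * (b - a)"
    using nonneg[OF h(2)] nonneg[OF h(3)] zero by (auto simp: algebra_simps)
  then have "a = b" using h(1) by (auto simp: zero_le_mult_iff)
  then have "a = 0" using zero by (simp add: algebra_simps)
  then show False using ne \<open>a = b\<close> by simp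
qed

text \<open>If the first coordinate of both drifts vanished, the condition on \<open>v\<close> would force the second
coordinate of \<open>g\<close> to be negative, and then the condition on \<open>l\<close> forces the same sign on that of \<open>r\<close>;
no mixture of the two would lie in the quadrant.\<close>

lemma drift_coordinate_nonzero:
  fixes a1 a2 b1 b2 :: real
  assumes v: "0 \<le> v1" "0 \<le> v2" "b1 * v1 + b2 * v2 < 0"
    and l: "0 < a1 * l1 + a2 * l2" "0 < b1 * l1 + b2 * l2"
    and \<delta>: "0 < \<delta>" "\<delta> < 1" "0 \<le> \<delta> * a2 + (1 - \<delta>) * b2"
  shows "\<not> (a1 = 0 \<and> b1 = 0)"
proof
  assume z: "a1 = 0 \<and> b1 = 0"
  have "b2 < 0" using v z by (auto simp: mult_less_0_iff)
  then have "l2 < 0" using l(2) z by (auto simp: zero_less_mult_iff)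
  then have "a2 < 0" using l(1) z by (auto simp: zero_less_mult_iff)
  have "\<delta> * a2 < 0" "(1 - \<delta>) * b2 < 0"
    using \<delta> \<open>a2 < 0\<close> \<open>b2 < 0\<close> by (auto simp: mult_less_0_iff)
  then show False using \<delta>(3) by linarith
qed

text \<open>Here \<open>a\<close>, \<open>b\<close> are a coordinate of the drifts of the two actions and \<open>A\<close>, \<open>B\<close> their components
along \<open>l\<close>. The weight \<open>\<beta> = q (a - b)\<close> is what the worse action lacks compared with the mixture at a
fresh site: at revisits the worse action is helped by \<open>\<beta> \<rho>\<close>, and the charge \<open>\<beta>\<close> at a fresh site
consumes exactly the surplus there. In both cases at least \<open>b + q \<rho> (a - b)\<close> remains, the value of the
affine interpolation at frequency \<open>q \<rho>\<close>.\<close>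

lemma compensator_of_gap:
  fixes a b A B \<rho> q :: real
  assumes ba: "b \<le> a" and AB: "\<rho> \<le> A" "\<rho> \<le> B" and q: "0 \<le> q" "q \<le> 1"
    and pos: "0 < b + q * \<rho> * (a - b)"
  shows "\<exists>\<beta>\<ge>0. \<exists>\<eta>>0. \<eta> \<le> q * (a + \<beta> * A) + (1 - q) * (b + \<beta> * B) - \<beta> \<and>
           \<eta> \<le> a + \<beta> * A \<and> \<eta> \<le> b + \<beta> * B"
proof -
  define \<beta> where "\<beta> = q * (a - b)"
  have \<beta>: "0 \<le> \<beta>" using ba q by (simp add: \<beta>_def)
  have bA: "\<beta> * \<rho> \<le> \<beta> * A" "\<beta> * \<rho> \<le> \<beta> * B" using AB \<beta> by (auto intro: mult_left_mono)
  have "q * (\<beta> * \<rho>) + (1 - q) * (\<beta> * \<rho>) \<le> q * (\<beta> * A) + (1 - q) * (\<beta> * B)"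
    using AB \<beta> q by (intro add_mono mult_left_mono) auto
  then have "b + \<beta> * \<rho> \<le> q * (a + \<beta> * A) + (1 - q) * (b + \<beta> * B) - q * (a - b)"
    by (simp add: algebra_simps)
  moreover have "b + \<beta> * \<rho> \<le> a + \<beta> * A" "b + \<beta> * \<rho> \<le> b + \<beta> * B"
    using bA ba by auto
  moreover have "0 < b + \<beta> * \<rho>" using pos by (simp add: \<beta>_def algebra_simps)
  ultimately show ?thesis using \<beta> \<beta>_def by blast
qed

text \<open>The frequency of \<open>r\<close> is at least \<open>q \<rho>\<close> and at most \<open>1 - (1 - q) \<rho>\<close>. The affine interpolation
between \<open>b\<close> and \<open>a\<close> has to be positive at the smaller bound if \<open>r\<close> is the better action, and at the
larger one otherwise; the second case is the first one with the actions exchanged.\<close>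

lemma exists_compensator:
  fixes a b A B \<rho> q \<alpha>0 \<alpha>1 :: real
  assumes pos: "\<And>\<delta>. \<delta> \<in> {\<alpha>0<..<\<alpha>1} \<Longrightarrow> 0 < \<delta> * a + (1 - \<delta>) * b"
    and AB: "\<rho> \<le> A" "\<rho> \<le> B" and q: "0 \<le> q" "q \<le> 1" "\<alpha>0 < q * \<rho>" "q * \<rho> < \<alpha>1 - 1 + \<rho>"
    and \<alpha>: "\<alpha>0 < \<alpha>1"
  shows "\<exists>\<beta>\<ge>0. \<exists>\<eta>>0. \<eta> \<le> q * (a + \<beta> * A) + (1 - q) * (b + \<beta> * B) - \<beta> \<and>
           \<eta> \<le> a + \<beta> * A \<and> \<eta> \<le> b + \<beta> * B"
proof (cases "b \<le> a")
  case True
  have "\<alpha>0 < min (q * \<rho>) \<alpha>1" using q(3) \<alpha> by simp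
  from dense[OF this] obtain \<delta> where \<delta>: "\<delta> \<in> {\<alpha>0<..<\<alpha>1}" "\<delta> \<le> q * \<rho>"
    by auto
  have "0 < b + \<delta> * (a - b)" using pos[OF \<delta>(1)] by (simp add: algebra_simps)
  also have "\<dots> \<le> b + (q * \<rho>) * (a - b)"
    using \<delta>(2) True by (intro add_left_mono mult_right_mono) auto
  finally show ?thesis using compensator_of_gap[OF True AB q(1,2)] by blast
next
  case False
  have "max (1 - (1 - q) * \<rho>) \<alpha>0 < \<alpha>1" using q(4) \<alpha> by (simp add: algebra_simps)
  from dense[OF this] obtain \<delta> where \<delta>: "\<delta> \<in> {\<alpha>0<..<\<alpha>1}" "1 - \<delta> \<le> (1 - q) * \<rho>"
    by auto
  have "0 < a + (1 - \<delta>) * (b - a)" using pos[OF \<delta>(1)] by (simp add: algebra_simps)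
  also have "\<dots> \<le> a + ((1 - q) * \<rho>) * (b - a)"
    using \<delta>(2) False by (intro add_left_mono mult_right_mono) auto
  finally obtain \<beta> \<eta> where "0 \<le> \<beta>" "0 < \<eta>"
    "\<eta> \<le> (1 - q) * (b + \<beta> * B) + (1 - (1 - q)) * (a + \<beta> * A) - \<beta>"
    "\<eta> \<le> b + \<beta> * B" "\<eta> \<le> a + \<beta> * A"
    using compensator_of_gap[of a b \<rho> B A "1 - q"] False AB q by auto
  moreover have "(1 - q) * (b + \<beta> * B) + (1 - (1 - q)) * (a + \<beta> * A) =
      q * (a + \<beta> * A) + (1 - q) * (b + \<beta> * B)"
    by simp
  ultimately show ?thesis by metis
qed

section \<open>Exponential moments of walks with positive drift\<close>

lemma exp_le_quadratic:
  fixes x :: real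
  assumes "\<bar>x\<bar> \<le> 1"
  shows "exp x \<le> 1 + x + x\<^sup>2"
proof (cases "0 \<le> x")
  case True
  then show ?thesis using exp_bound assms by simp
next
  case False
  define y where "y = - x"
  have y: "0 \<le> y" using False by (simp add: y_def)
  \<comment> \<open>The product is \<open>1 + y ^ 3\<close>.\<close>
  have "1 \<le> (1 - y + y\<^sup>2) * (1 + y)"
    using y by (simp add: algebra_simps power2_eq_square)
  also have "\<dots> \<le> (1 - y + y\<^sup>2) * exp y"
  proof (rule mult_left_mono)
    show "1 + y \<le> exp y" by (rule exp_ge_add_one_self)
    show "0 \<le> 1 - y + y\<^sup>2"
      using zero_le_power2[of "y - 1 / 2"] by (simp add: power2_eq_square algebra_simps)
  qed
  finally have "exp (- y) \<le> 1 - y + y\<^sup>2"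
    by (simp add: exp_minus inverse_eq_divide pos_divide_le_eq)
  then show ?thesis by (simp add: y_def)
qed

text \<open>Second-order expansion: the drift contributes \<open>- \<theta> \<eta>\<close> to the exponential moment and the bounded
fluctuations at most \<open>\<theta>\<^sup>2 B\<^sup>2\<close>, which is no more than \<open>\<theta> \<eta>\<close> once \<open>\<theta>\<close> is small.\<close>

lemma exp_decrease_of_positive_drift:
  fixes f :: "'a \<Rightarrow> real"
  assumes fin: "finite (set_pmf M)" and B: "\<And>x. x \<in> set_pmf M \<Longrightarrow> \<bar>f x\<bar> \<le> B"
    and drift: "\<eta> \<le> measure_pmf.expectation M f"
    and \<theta>: "0 \<le> \<theta>" "\<theta> * B \<le> 1" "\<theta> * B\<^sup>2 \<le> \<eta>"
  shows "measure_pmf.expectation M (\<lambda>x. exp (- \<theta> * f x)) \<le> 1"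
proof -
  note int = integrable_measure_pmf_finite[OF fin]
  have "measure_pmf.expectation M (\<lambda>x. exp (- \<theta> * f x)) \<le>
      measure_pmf.expectation M (\<lambda>x. 1 - \<theta> * f x + \<theta> * (\<theta> * B\<^sup>2))"
  proof (intro integral_mono_AE int AE_pmfI)
    fix x assume x: "x \<in> set_pmf M"
    have "\<bar>- \<theta> * f x\<bar> \<le> \<theta> * B"
      using B[OF x] \<theta>(1) by (simp add: abs_mult mult_left_mono)
    then have "exp (- \<theta> * f x) \<le> 1 + (- \<theta> * f x) + (- \<theta> * f x)\<^sup>2"
      using \<theta>(2) by (intro exp_le_quadratic) linarith
    also have "(- \<theta> * f x)\<^sup>2 \<le> (\<theta> * B)\<^sup>2"
      using power_mono[OF \<open>\<bar>- \<theta> * f x\<bar> \<le> \<theta> * B\<close>, of 2] by (simp only: power2_abs abs_ge_zero)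
    finally show "exp (- \<theta> * f x) \<le> 1 - \<theta> * f x + \<theta> * (\<theta> * B\<^sup>2)"
      by (simp add: power2_eq_square algebra_simps)
  qed
  also have "\<dots> = 1 - \<theta> * measure_pmf.expectation M f + \<theta> * (\<theta> * B\<^sup>2)"
    by (simp add: int)
  also have "\<dots> \<le> 1 - \<theta> * \<eta> + \<theta> * \<eta>"
    using \<theta> drift by (intro add_mono diff_left_mono mult_left_mono) auto
  finally show ?thesis by simp
qed

section \<open>One step of the walk in the quadrant\<close>

definition unit_steps :: "state set" where
  "unit_steps = {e1, - e1, e2, - e2}"

definition interior_sites :: "state set" where
  "interior_sites = {x. 0 < fst x \<and> 0 < snd x}"

lemma interior_sites_subset: "interior_sites \<subseteq> quadrant"
  by (auto simp: interior_sites_def quadrant_def)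

lemma finite_unit_steps [simp]: "finite unit_steps"
  by (simp add: unit_steps_def)

lemma sum_unit_steps:
  fixes f :: "state \<Rightarrow> real"
  shows "sum f unit_steps = f e1 + f (- e1) + f e2 + f (- e2)"
  by (simp add: unit_steps_def e1_def e2_def)

lemma to_plane_add: "to_plane (x + y) = to_plane x + to_plane y"
  by (simp add: to_plane_def)

lemma to_plane_unit_steps:
  "to_plane e1 = (1, 0)" "to_plane (- e1) = (- 1, 0)" "to_plane e2 = (0, 1)" "to_plane (- e2) = (0, - 1)"
  by (simp_all add: to_plane_def e1_def e2_def)

lemma norm_unit_step: "e \<in> unit_steps \<Longrightarrow> norm (to_plane e) = 1"
  by (auto simp: unit_steps_def to_plane_unit_steps norm_prod_def)

lemma inner_unit_step_le: "e \<in> unit_steps \<Longrightarrow> \<bar>to_plane e \<bullet> u\<bar> \<le> norm u"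
  using Cauchy_Schwarz_ineq2[of "to_plane e" u] norm_unit_step[of e] by simp

lemma sum_step_dist:
  assumes "M \<in> step_dists" shows "(\<Sum>e\<in>unit_steps. pmf M e) = 1"
  using assms by (intro sum_pmf_eq_1) (auto simp: step_dists_def unit_steps_def)

lemma drift_inner_le_1:
  assumes M: "M \<in> step_dists" and l: "norm l = 1"
  shows "drift M \<bullet> l \<le> 1"
proof -
  have "drift M \<bullet> l = (\<Sum>e\<in>unit_steps. pmf M e * (to_plane e \<bullet> l))"
    unfolding sum_unit_steps to_plane_unit_steps drift_def inner_prod_def by (simp add: algebra_simps)
  also have "\<dots> \<le> (\<Sum>e\<in>unit_steps. pmf M e * 1)"
  proof (intro sum_mono mult_left_mono)
    fix e assume "e \<in> unit_steps"
    from inner_unit_step_le[OF this, of l] show "to_plane e \<bullet> l \<le> 1" using l by simp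
  qed simp
  also have "\<dots> = 1" using sum_step_dist[OF M] by simp
  finally show ?thesis .
qed

lemma drift_coordinates:
  "drift M \<bullet> to_plane e1 = fst (drift M)" "drift M \<bullet> to_plane e2 = snd (drift M)"
  by (simp_all add: to_plane_unit_steps inner_prod_def)

lemma drift_sum_le: "M \<in> step_dists \<Longrightarrow> fst (drift M) + snd (drift M) \<le> 1"
proof -
  assume "M \<in> step_dists"
  then have "pmf M e1 + pmf M (- e1) + pmf M e2 + pmf M (- e2) = 1"
    using sum_step_dist[of M] by (simp add: sum_unit_steps)
  moreover have "0 \<le> pmf M (- e1)" "0 \<le> pmf M (- e2)" by simp_all
  ultimately show ?thesis unfolding drift_def fst_conv snd_conv by linarith
qed

locale quadrant_llp =
  fixes p :: "state \<Rightarrow> action \<Rightarrow> state pmf"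
    and \<mu> \<mu>' \<mu>'' :: "action \<Rightarrow> state pmf"
    and \<phi> :: decision_rule and \<psi> :: update_rule and \<beta>0 :: env
  assumes transitions: "quadrant_transitions p \<mu> \<mu>' \<mu>''"
    and admissible: "admissible_llp \<phi> \<beta>0"
begin

definition fresh_prob :: real where
  "fresh_prob = pmf (\<phi> (\<beta>0 (0, 0))) Act_r"

definition fresh_drift :: "real \<times> real" where
  "fresh_drift = fresh_prob *\<^sub>R drift (\<mu> Act_r) + (1 - fresh_prob) *\<^sub>R drift (\<mu> Act_g)"

lemma fresh_action_prob: "x \<in> quadrant \<Longrightarrow> pmf (\<phi> (\<beta>0 x)) Act_r = fresh_prob"
proof -
  assume x: "x \<in> quadrant"
  have "(0, 0) \<in> quadrant" by (simp add: quadrant_def)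
  then have "\<beta>0 x = \<beta>0 (0, 0)" using admissible x unfolding admissible_llp_def by blast
  then show ?thesis by (simp add: fresh_prob_def)
qed

lemma fresh_action_possible: "x \<in> quadrant \<Longrightarrow> a \<in> set_pmf (\<phi> (\<beta>0 x))"
  using admissible unfolding admissible_llp_def set_pmf_iff by (metis less_irrefl)

lemma fresh_prob_bounds: "0 < fresh_prob" "fresh_prob < 1"
proof -
  have "(0, 0) \<in> quadrant" by (simp add: quadrant_def)
  then have "0 < pmf (\<phi> (\<beta>0 (0, 0))) Act_r" "0 < pmf (\<phi> (\<beta>0 (0, 0))) Act_g"
    using admissible unfolding admissible_llp_def by blast+
  then show "0 < fresh_prob" "fresh_prob < 1"
    by (auto simp: fresh_prob_def pmf_Act_g)
qed

lemma pmf_transition: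
  assumes "e \<in> unit_steps"
  shows "x \<in> interior_sites \<Longrightarrow> pmf (p x a) (x + e) = pmf (\<mu> a) e"
    and "0 < fst x \<Longrightarrow> snd x = 0 \<Longrightarrow> pmf (p x a) (x + e) = pmf (\<mu>' a) e"
    and "fst x = 0 \<Longrightarrow> 0 < snd x \<Longrightarrow> pmf (p x a) (x + e) = pmf (\<mu>'' a) e"
proof -
  have "\<forall>x a. \<forall>e\<in>unit_steps.
        (0 < fst x \<and> 0 < snd x \<longrightarrow> pmf (p x a) (x + e) = pmf (\<mu> a) e) \<and>
        (0 < fst x \<and> snd x = 0 \<longrightarrow> pmf (p x a) (x + e) = pmf (\<mu>' a) e) \<and>
        (fst x = 0 \<and> 0 < snd x \<longrightarrow> pmf (p x a) (x + e) = pmf (\<mu>'' a) e)"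
    using transitions unfolding quadrant_transitions_def unit_steps_def by (elim conjE) assumption
  note * = this[rule_format, OF assms, of x a]
  show "x \<in> interior_sites \<Longrightarrow> pmf (p x a) (x + e) = pmf (\<mu> a) e"
    and "0 < fst x \<Longrightarrow> snd x = 0 \<Longrightarrow> pmf (p x a) (x + e) = pmf (\<mu>' a) e"
    and "fst x = 0 \<Longrightarrow> 0 < snd x \<Longrightarrow> pmf (p x a) (x + e) = pmf (\<mu>'' a) e"
    using * by (simp_all add: interior_sites_def)
qed

lemma mu_step_dist: "\<mu> a \<in> step_dists" "\<mu>' a \<in> step_dists" "\<mu>'' a \<in> step_dists"
  using transitions unfolding quadrant_transitions_def by blast+

lemma set_transition:
  assumes x: "x \<in> quadrant"
  shows "set_pmf (p x a) \<subseteq> (+) x ` unit_steps"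
proof (cases "x = (0, 0)")
  case True
  have "pmf (p (0, 0) a) e1 + pmf (p (0, 0) a) e2 = 1"
    using transitions unfolding quadrant_transitions_def by blast
  then have "set_pmf (p (0, 0) a) \<subseteq> {e1, e2}"
    by (intro set_pmf_subset_if_sum_pmf_eq_1) (auto simp: e1_def e2_def)
  then show ?thesis using True by (auto simp: unit_steps_def zero_prod_def[symmetric])
next
  case False
  then consider "x \<in> interior_sites" | "0 < fst x" "snd x = 0" | "fst x = 0" "0 < snd x"
    using x by (cases x) (force simp: quadrant_def interior_sites_def)
  then have "\<exists>M\<in>step_dists. \<forall>e\<in>unit_steps. pmf (p x a) (x + e) = pmf M e"
  proof cases
    case 1
    then show ?thesis using pmf_transition(1) mu_step_dist(1) by blast
  next
    case 2
    then show ?thesis using pmf_transition(2) mu_step_dist(2) by blast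
  next
    case 3
    then show ?thesis using pmf_transition(3) mu_step_dist(3) by blast
  qed
  then have "(\<Sum>e\<in>unit_steps. pmf (p x a) (x + e)) = 1"
    using sum_step_dist by (metis (no_types, lifting) sum.cong)
  then have "(\<Sum>y\<in>(+) x ` unit_steps. pmf (p x a) y) = 1"
    by (subst sum.reindex) (auto simp: inj_on_def)
  then show ?thesis by (intro set_pmf_subset_if_sum_pmf_eq_1) auto
qed

lemma transition_in_quadrant: "x \<in> quadrant \<Longrightarrow> set_pmf (p x a) \<subseteq> quadrant"
  using transitions unfolding quadrant_transitions_def by blast

lemma finite_transition: "x \<in> quadrant \<Longrightarrow> finite (set_pmf (p x a))"
  by (rule finite_subset[OF set_transition]) simp_all

lemma expectation_interior_step:
  assumes x: "x \<in> interior_sites"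
  shows "measure_pmf.expectation (p x a) (\<lambda>y. (to_plane y - to_plane x) \<bullet> u) = drift (\<mu> a) \<bullet> u"
proof -
  have "x \<in> quadrant" using x interior_sites_subset by blast
  then have supp: "y \<in> (+) x ` unit_steps" if "y \<in> set_pmf (p x a)" for y
    using set_transition[of x a] that by blast
  have "measure_pmf.expectation (p x a) (\<lambda>y. (to_plane y - to_plane x) \<bullet> u) =
      (\<Sum>y\<in>(+) x ` unit_steps. pmf (p x a) y *\<^sub>R ((to_plane y - to_plane x) \<bullet> u))"
    by (rule integral_measure_pmf) (simp_all add: supp)
  also have "\<dots> = (\<Sum>e\<in>unit_steps. pmf (p x a) (x + e) * ((to_plane (x + e) - to_plane x) \<bullet> u))"
    by (subst sum.reindex) (simp_all add: inj_on_def)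
  also have "\<dots> = (\<Sum>e\<in>unit_steps. pmf (\<mu> a) e * (to_plane e \<bullet> u))"
    using x by (intro sum.cong refl) (simp add: to_plane_add pmf_transition)
  also have "\<dots> = drift (\<mu> a) \<bullet> u"
    unfolding sum_unit_steps to_plane_unit_steps drift_def inner_prod_def by (simp add: algebra_simps)
  finally show ?thesis .
qed

lemma set_trace_step:
  "set_pmf (trace_step p \<phi> \<psi> (xs, b)) =
     (\<Union>a\<in>set_pmf (\<phi> (b (hd xs))). \<Union>y\<in>set_pmf (p (hd xs) a). {(y # xs, env_update \<psi> b (hd xs) a y)})"
  by (auto simp: trace_step_def)

lemma finite_trace_step:
  "hd xs \<in> quadrant \<Longrightarrow> finite (set_pmf (trace_step p \<phi> \<psi> (xs, b)))"
  unfolding set_trace_step by (auto intro: finite_transition)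

lemma expectation_trace_step:
  fixes F :: "state list \<Rightarrow> real"
  assumes "hd xs \<in> quadrant"
  shows "measure_pmf.expectation (trace_step p \<phi> \<psi> (xs, b)) (\<lambda>s. F (fst s)) =
    pmf (\<phi> (b (hd xs))) Act_r * measure_pmf.expectation (p (hd xs) Act_r) (\<lambda>y. F (y # xs)) +
    pmf (\<phi> (b (hd xs))) Act_g * measure_pmf.expectation (p (hd xs) Act_g) (\<lambda>y. F (y # xs))"
proof -
  have "measure_pmf.expectation (trace_step p \<phi> \<psi> (xs, b)) (\<lambda>s. F (fst s)) =
     (\<Sum>a\<in>UNIV. pmf (\<phi> (b (hd xs))) a *\<^sub>R measure_pmf.expectation (p (hd xs) a) (\<lambda>y. F (y # xs)))"
    unfolding trace_step_def prod.case
    using assms by (subst pmf_expectation_bind[where A=UNIV]) (auto intro: finite_transition)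
  then show ?thesis by (simp add: UNIV_action)
qed

end

section \<open>The potential of a trace\<close>

text \<open>The subtracted term charges \<open>\<beta>\<close> for every interior site that has been left before. Passing to the
next site raises this number by one exactly if the present interior site is fresh, hence the charge does
not depend on where the walk moves.\<close>

definition potential :: "real \<times> real \<Rightarrow> real \<Rightarrow> state list \<Rightarrow> real" where
  "potential u \<beta> xs = to_plane (hd xs) \<bullet> u - \<beta> * card (set (tl xs) \<inter> interior_sites)"

lemma potential_Cons:
  assumes "xs \<noteq> []" "hd xs \<in> interior_sites"
  shows "potential u \<beta> (y # xs) = potential u \<beta> xs + (to_plane y - to_plane (hd xs)) \<bullet> u
           - (if hd xs \<in> set (tl xs) then 0 else \<beta>)"
proof -
  have "set xs = insert (hd xs) (set (tl xs))"
    using assms by (cases xs) auto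
  then have "card (set xs \<inter> interior_sites) =
      card (set (tl xs) \<inter> interior_sites) + (if hd xs \<in> set (tl xs) then 0 else 1)"
    using assms by (auto simp: insert_absorb)
  then show ?thesis
    by (auto simp: potential_def inner_diff_left algebra_simps)
qed

text \<open>The quantitative content of the model assumptions for \<open>q\<close> in the right range. The weight \<open>\<beta> e\<close> for
the coordinate direction \<open>e\<close> is the one provided by \<open>exists_compensator\<close>, and \<open>\<eta>\<close> works for both
coordinates.\<close>

locale drifting_llp = quadrant_llp +
  fixes l :: "real \<times> real" and \<beta> :: "state \<Rightarrow> real" and \<eta> :: real
  assumes norm_l: "norm l = 1"
    and eta_pos: "0 < \<eta>"
    and beta_nonneg: "e \<in> {e1, e2} \<Longrightarrow> 0 \<le> \<beta> e"
    and fresh_gain: "e \<in> {e1, e2} \<Longrightarrow> \<eta> \<le>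
      fresh_drift \<bullet> (to_plane e + \<beta> e *\<^sub>R l) - \<beta> e"
    and revisit_gain: "e \<in> {e1, e2} \<Longrightarrow> \<eta> \<le> drift (\<mu> a) \<bullet> (to_plane e + \<beta> e *\<^sub>R l)"
    and fresh_drift_pos: "0 < fst fresh_drift"
      "0 < snd fresh_drift"
begin

definition dir :: "state \<Rightarrow> real \<times> real" where
  "dir e = to_plane e + \<beta> e *\<^sub>R l"

text \<open>On a revisit the environment at the site is arbitrary, so that the next action has an arbitrary law;
the bound holds because each action separately gains at least \<open>\<eta>\<close>.\<close>

lemma expected_potential_gain:
  assumes e: "e \<in> {e1, e2}" and xs: "xs \<noteq> []" "hd xs \<in> interior_sites"
    and b: "hd xs \<notin> set (tl xs) \<Longrightarrow> b (hd xs) = \<beta>0 (hd xs)"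
  shows "\<eta> \<le> measure_pmf.expectation (trace_step p \<phi> \<psi> (xs, b))
           (\<lambda>s. potential (dir e) (\<beta> e) (fst s) - potential (dir e) (\<beta> e) xs)"
proof -
  let ?x = "hd xs"
  let ?pr = "pmf (\<phi> (b ?x)) Act_r"
  define K where "K = (if ?x \<in> set (tl xs) then 0 else \<beta> e)"
  have xq: "?x \<in> quadrant" using xs interior_sites_subset by blast
  have E: "measure_pmf.expectation (p ?x a)
      (\<lambda>y. potential (dir e) (\<beta> e) (y # xs) - potential (dir e) (\<beta> e) xs) = drift (\<mu> a) \<bullet> dir e - K" for a
  proof -
    have "measure_pmf.expectation (p ?x a)
        (\<lambda>y. potential (dir e) (\<beta> e) (y # xs) - potential (dir e) (\<beta> e) xs) =
      measure_pmf.expectation (p ?x a) (\<lambda>y. (to_plane y - to_plane ?x) \<bullet> dir e - K)"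
      by (simp add: potential_Cons[OF xs] K_def algebra_simps)
    also have "\<dots> = measure_pmf.expectation (p ?x a) (\<lambda>y. (to_plane y - to_plane ?x) \<bullet> dir e) - K"
      by (subst Bochner_Integration.integral_diff)
        (auto intro: integrable_measure_pmf_finite finite_transition[OF xq])
    finally show ?thesis by (simp add: expectation_interior_step[OF xs(2)])
  qed
  have eq: "measure_pmf.expectation (trace_step p \<phi> \<psi> (xs, b))
      (\<lambda>s. potential (dir e) (\<beta> e) (fst s) - potential (dir e) (\<beta> e) xs) =
    ?pr * (drift (\<mu> Act_r) \<bullet> dir e) + (1 - ?pr) * (drift (\<mu> Act_g) \<bullet> dir e) - K"
    using expectation_trace_step[OF xq, where F="\<lambda>zs. potential (dir e) (\<beta> e) zs - potential (dir e) (\<beta> e) xs"]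
    by (simp add: E pmf_Act_g algebra_simps)
  show ?thesis
  proof (cases "?x \<in> set (tl xs)")
    case True
    have "?pr * \<eta> + (1 - ?pr) * \<eta> \<le>
        ?pr * (drift (\<mu> Act_r) \<bullet> dir e) + (1 - ?pr) * (drift (\<mu> Act_g) \<bullet> dir e)"
      using revisit_gain[OF e] by (intro add_mono mult_left_mono) (auto simp: dir_def pmf_le_1)
    then show ?thesis unfolding eq using True by (simp add: K_def algebra_simps)
  next
    case False
    then have "?pr = fresh_prob" using b fresh_action_prob[OF xq] by simp
    then show ?thesis
      unfolding eq using False fresh_gain[OF e] by (simp add: K_def dir_def fresh_drift_def inner_add_left)
  qed
qed

text \<open>The time-dependent term \<open>c * length xs\<close> makes the later confinement region recede at speed \<open>c\<close>.\<close>

lemma exp_potential_supermartingale: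
  assumes c: "0 \<le> c" "c < \<eta>" and e: "e \<in> {e1, e2}"
  shows "\<exists>\<theta>>0. \<forall>xs b. xs \<noteq> [] \<and> hd xs \<in> interior_sites \<and>
      (hd xs \<notin> set (tl xs) \<longrightarrow> b (hd xs) = \<beta>0 (hd xs)) \<longrightarrow>
      measure_pmf.expectation (trace_step p \<phi> \<psi> (xs, b))
        (\<lambda>s. exp (- \<theta> * (potential (dir e) (\<beta> e) (fst s) - c * length (fst s)))) \<le>
      exp (- \<theta> * (potential (dir e) (\<beta> e) xs - c * length xs))"
proof -
  define B where "B = norm (dir e) + \<beta> e + c + 1"
  have B: "0 < B" using beta_nonneg[OF e] c unfolding B_def by (simp add: add_nonneg_pos)
  define \<theta> where "\<theta> = min (1 / B) ((\<eta> - c) / B\<^sup>2)"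
  have B2: "0 < B\<^sup>2" using B by simp
  have "\<theta> \<le> 1 / B" "\<theta> \<le> (\<eta> - c) / B\<^sup>2"
    by (simp_all add: \<theta>_def)
  then have \<theta>: "\<theta> * B \<le> 1" "\<theta> * B\<^sup>2 \<le> \<eta> - c"
    using pos_le_divide_eq[OF B] pos_le_divide_eq[OF B2] by simp_all
  have \<theta>0: "0 < \<theta>" using B c by (simp add: \<theta>_def)
  show ?thesis
  proof (intro exI[of _ \<theta>] conjI allI impI \<theta>0)
    fix xs b
    assume as: "xs \<noteq> [] \<and> hd xs \<in> interior_sites \<and> (hd xs \<notin> set (tl xs) \<longrightarrow> b (hd xs) = \<beta>0 (hd xs))"
    let ?M = "trace_step p \<phi> \<psi> (xs, b)"
    let ?P = "potential (dir e) (\<beta> e)"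
    have xq: "hd xs \<in> quadrant" using as interior_sites_subset by blast
    note fin = finite_trace_step[OF xq, of b]
    have bound: "\<bar>?P (fst s) - ?P xs - c\<bar> \<le> B" if supp: "s \<in> set_pmf ?M" for s
    proof -
      obtain a y where y: "y \<in> set_pmf (p (hd xs) a)"
        and s: "s = (y # xs, env_update \<psi> b (hd xs) a y)"
        using supp unfolding set_trace_step by blast
      have ay: "fst s = y # xs" by (simp add: s)
      then obtain d where d: "d \<in> unit_steps" "y = hd xs + d"
        using y set_transition[OF xq] by blast
      have "\<bar>to_plane d \<bullet> dir e\<bar> \<le> norm (dir e)" by (rule inner_unit_step_le[OF d(1)])
      then show ?thesis
        using as c beta_nonneg[OF e] unfolding ay B_def
        by (auto simp: potential_Cons d to_plane_add)
    qed
    have "measure_pmf.expectation ?M (\<lambda>s. ?P (fst s) - ?P xs - c) =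
        measure_pmf.expectation ?M (\<lambda>s. ?P (fst s) - ?P xs) - c"
      by (subst Bochner_Integration.integral_diff) (auto intro: integrable_measure_pmf_finite[OF fin])
    then have "\<eta> - c \<le> measure_pmf.expectation ?M (\<lambda>s. ?P (fst s) - ?P xs - c)"
      using expected_potential_gain[OF e, of xs b] as by simp
    with bound \<theta> \<theta>0 fin have le1: "measure_pmf.expectation ?M (\<lambda>s. exp (- \<theta> * (?P (fst s) - ?P xs - c))) \<le> 1"
      by (intro exp_decrease_of_positive_drift[where B=B and \<eta>="\<eta> - c"]) auto
    have "measure_pmf.expectation ?M (\<lambda>s. exp (- \<theta> * (?P (fst s) - c * length (fst s)))) =
      measure_pmf.expectation ?M (\<lambda>s. exp (- \<theta> * (?P xs - c * length xs)) * exp (- \<theta> * (?P (fst s) - ?P xs - c)))"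
    proof (intro integral_cong_AE AE_pmfI)
      fix s assume "s \<in> set_pmf ?M"
      then have "length (fst s) = Suc (length xs)" unfolding set_trace_step by auto
      then show "exp (- \<theta> * (?P (fst s) - c * length (fst s))) =
          exp (- \<theta> * (?P xs - c * length xs)) * exp (- \<theta> * (?P (fst s) - ?P xs - c))"
        by (simp add: exp_add[symmetric] algebra_simps)
    qed auto
    also have "\<dots> = exp (- \<theta> * (?P xs - c * length xs)) *
        measure_pmf.expectation ?M (\<lambda>s. exp (- \<theta> * (?P (fst s) - ?P xs - c)))"
      by simp
    also have "\<dots> \<le> exp (- \<theta> * (?P xs - c * length xs))"
      using mult_left_mono[OF le1, of "exp (- \<theta> * (?P xs - c * length xs))"] by simp
    finally show "measure_pmf.expectation ?M (\<lambda>s. exp (- \<theta> * (?P (fst s) - c * length (fst s)))) \<le>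
        exp (- \<theta> * (?P xs - c * length xs))" .
  qed
qed

end

section \<open>Confinement to a receding region\<close>

text \<open>The index of a site in a newest-first list is the length of the list after it, that is, the time of
the visit.\<close>

primrec follows :: "(nat \<Rightarrow> state set) \<Rightarrow> state list \<Rightarrow> bool" where
  "follows S [] \<longleftrightarrow> True"
| "follows S (x # xs) \<longleftrightarrow> x \<in> S (length xs) \<and> follows S xs"

lemma follows_mono:
  assumes "follows S xs" "\<And>k. k < length xs \<Longrightarrow> S k \<subseteq> S' k"
  shows "follows S' xs"
  using assms by (induction xs) auto

lemma follows_map_rev:
  "follows S (map f (rev [0..<n])) \<longleftrightarrow> (\<forall>k<n. f k \<in> S k)"
  by (induction n) (auto simp: less_Suc_eq)

context quadrant_llp
begin

text \<open>Only left sites can have been updated, so the head of the trace still counts as unvisited unless it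
occurs in the tail.\<close>

definition unvisited_initial :: "trace \<Rightarrow> bool" where
  "unvisited_initial s \<longleftrightarrow> (\<forall>z. z \<notin> set (tl (fst s)) \<longrightarrow> snd s z = \<beta>0 z)"

lemma unvisited_initial_step:
  assumes "unvisited_initial s" "fst s \<noteq> []" "s' \<in> set_pmf (trace_step p \<phi> \<psi> s)"
  shows "unvisited_initial s'"
proof -
  obtain xs b where s: "s = (xs, b)" by (cases s)
  obtain a y where s': "s' = (y # xs, env_update \<psi> b (hd xs) a y)"
    using assms(3) unfolding s set_trace_step by blast
  show ?thesis
    unfolding unvisited_initial_def
  proof (intro allI impI)
    fix z assume "z \<notin> set (tl (fst s'))"
    then have "z \<notin> set xs" by (simp add: s')
    then have "z \<noteq> hd xs" "z \<notin> set (tl xs)"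
      using assms(2) s by (auto simp: hd_in_set list.set_sel(2))
    then show "snd s' z = \<beta>0 z"
      using assms(1) \<open>z \<noteq> hd xs\<close> \<open>z \<notin> set (tl xs)\<close> unfolding s s' unvisited_initial_def env_update_def fst_conv snd_conv
      by (metis fun_upd_other)
  qed
qed

lemma reachable_trace:
  assumes "s \<in> set_pmf (trace_after p \<phi> \<psi> n ([x], \<beta>0))" and x: "x \<in> quadrant"
  shows "unvisited_initial s \<and> length (fst s) = Suc n \<and> set (fst s) \<subseteq> quadrant"
  using assms(1)
proof (induction n arbitrary: s)
  case 0
  then show ?case using x by (auto simp: unvisited_initial_def)
next
  case (Suc n)
  from Suc.prems obtain s0 where s0: "s0 \<in> set_pmf (trace_after p \<phi> \<psi> n ([x], \<beta>0))"
    and s: "s \<in> set_pmf (trace_step p \<phi> \<psi> s0)"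
    unfolding trace_after_Suc_right by auto
  note IH = Suc.IH[OF s0]
  obtain xs b where s0_eq: "s0 = (xs, b)" by (cases s0)
  have ne: "xs \<noteq> []" using IH s0_eq by auto
  then have "hd xs \<in> quadrant" using IH s0_eq hd_in_set[of xs] by auto
  moreover obtain a y where y: "y \<in> set_pmf (p (hd xs) a)"
      and s_eq: "s = (y # xs, env_update \<psi> b (hd xs) a y)"
    using s unfolding s0_eq set_trace_step by blast
  ultimately have "y \<in> quadrant" using transition_in_quadrant by blast
  then have "set (fst s) \<subseteq> quadrant" "length (fst s) = Suc (Suc n)"
    using IH unfolding s0_eq s_eq by simp_all
  moreover have "unvisited_initial s"
    using unvisited_initial_step[OF _ _ s] IH ne s0_eq by simp
  ultimately show ?case by simp
qed

end

text \<open>In an application \<open>L\<close> is the value of \<open>l\<close> at the first interior site. The bound then says that a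
visited site \<open>j\<close> units further along \<open>l\<close> needs at least \<open>j + 1\<close> visited interior sites; the bound for
all visited sites, not only the present one, makes it an invariant when the walk leaves from an old
site.\<close>

definition line_bound :: "real \<times> real \<Rightarrow> real \<Rightarrow> state list \<Rightarrow> bool" where
  "line_bound l L xs \<longleftrightarrow>
     (\<forall>y\<in>set xs \<inter> interior_sites. to_plane y \<bullet> l - L + 1 \<le> card (set xs \<inter> interior_sites))"

lemma line_bound_step:
  assumes lb: "line_bound l L xs" and l: "norm l = 1"
    and xs: "xs \<noteq> []" "hd xs \<in> interior_sites" and d: "d \<in> unit_steps"
  shows "to_plane (hd xs + d) \<bullet> l - L \<le> card (set xs \<inter> interior_sites)"
    and "line_bound l L ((hd xs + d) # xs)"
proof -
  let ?y = "hd xs + d"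
  have "to_plane (hd xs) \<bullet> l - L + 1 \<le> card (set xs \<inter> interior_sites)"
    using lb xs by (auto simp: line_bound_def)
  moreover have "to_plane d \<bullet> l \<le> 1"
    using inner_unit_step_le[OF d, of l] l by simp
  ultimately show y: "to_plane ?y \<bullet> l - L \<le> card (set xs \<inter> interior_sites)"
    by (simp add: to_plane_add inner_add_left)
  show "line_bound l L (?y # xs)"
    unfolding line_bound_def
  proof
    fix z assume z: "z \<in> set (?y # xs) \<inter> interior_sites"
    have mono: "card (set xs \<inter> interior_sites) \<le> card (set (?y # xs) \<inter> interior_sites)"
      by (intro card_mono) auto
    show "to_plane z \<bullet> l - L + 1 \<le> card (set (?y # xs) \<inter> interior_sites)"
    proof (cases "z \<in> set xs")
      case True
      then have "to_plane z \<bullet> l - L + 1 \<le> card (set xs \<inter> interior_sites)"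
        using lb z by (auto simp: line_bound_def)
      then show ?thesis using mono by linarith
    next
      case False
      then have "set (?y # xs) \<inter> interior_sites = insert z (set xs \<inter> interior_sites)" "z = ?y"
        using z by auto
      then have "card (set (?y # xs) \<inter> interior_sites) = Suc (card (set xs \<inter> interior_sites))"
        using False by (simp del: insert_iff)
      then show ?thesis using y \<open>z = ?y\<close> by simp
    qed
  qed
qed

lemma coordinate_pos_interior: 
  assumes "\<And>e. e \<in> {e1, e2} \<Longrightarrow> 0 < to_plane x \<bullet> to_plane e"
  shows "x \<in> interior_sites"
  using assms[of e1] assms[of e2]
  by (auto simp: interior_sites_def to_plane_def e1_def e2_def inner_prod_def)

context drifting_llp
begin

text \<open>Backward induction on the number of remaining steps. The sum of exponentials is a supermartingale as
long as the walk is in the interior, and it is at least \<open>1\<close> as soon as the walk violates the region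
\<open>S\<close>, because \<open>line_bound\<close> makes the potential a lower bound for the coordinate up to the constant
\<open>\<beta> e * L\<close>. Hence it bounds the probability of ever violating \<open>S\<close>.\<close>

lemma prob_follows_ge:
  fixes c :: real and \<kappa> \<theta> :: "state \<Rightarrow> real" and L :: real
  assumes c: "0 \<le> c"
    and \<theta>: "\<And>e. e \<in> {e1, e2} \<Longrightarrow> 0 < \<theta> e"
    and super: "\<And>e xs b. e \<in> {e1, e2} \<Longrightarrow> xs \<noteq> [] \<Longrightarrow> hd xs \<in> interior_sites \<Longrightarrow>
      (hd xs \<notin> set (tl xs) \<Longrightarrow> b (hd xs) = \<beta>0 (hd xs)) \<Longrightarrow>
      measure_pmf.expectation (trace_step p \<phi> \<psi> (xs, b))
        (\<lambda>s. exp (- \<theta> e * (potential (dir e) (\<beta> e) (fst s) - c * length (fst s)))) \<le>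
      exp (- \<theta> e * (potential (dir e) (\<beta> e) xs - c * length xs))"
    and S: "\<And>k. N \<le> k \<Longrightarrow> S k = {z. \<forall>e\<in>{e1, e2}. \<kappa> e + c * (real k + 1) \<le> to_plane z \<bullet> to_plane e}"
    and pos: "\<And>e. e \<in> {e1, e2} \<Longrightarrow> 0 < \<kappa> e + c * (real N + 1)"
  shows "xs \<noteq> [] \<Longrightarrow> hd xs \<in> interior_sites \<Longrightarrow> unvisited_initial (xs, b) \<Longrightarrow> line_bound l L xs \<Longrightarrow>
    N \<le> length xs \<Longrightarrow> follows S xs \<Longrightarrow>
    1 - (\<Sum>e\<in>{e1, e2}. exp (- \<theta> e * (potential (dir e) (\<beta> e) xs - c * length xs - (\<kappa> e + \<beta> e * L))))
      \<le> measure_pmf.prob (trace_after p \<phi> \<psi> n (xs, b)) {s. follows S (fst s)}"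
proof (induction n arbitrary: xs b)
  case 0
  then show ?case by (simp add: sum_nonneg)
next
  case (Suc n)
  define H where "H e xs = exp (- \<theta> e * (potential (dir e) (\<beta> e) xs - c * length xs - (\<kappa> e + \<beta> e * L)))" for e xs
  let ?M = "trace_step p \<phi> \<psi> (xs, b)"
  let ?A = "{s :: trace. follows S (fst s)}"
  have xq: "hd xs \<in> quadrant" using Suc.prems interior_sites_subset by blast
  note fin = finite_trace_step[OF xq, of b]
  note int = integrable_measure_pmf_finite[OF fin]
  have H_super: "measure_pmf.expectation ?M (\<lambda>s. H e (fst s)) \<le> H e xs" if e: "e \<in> {e1, e2}" for e
  proof -
    have split: "H e xs = exp (\<theta> e * (\<kappa> e + \<beta> e * L)) * exp (- \<theta> e * (potential (dir e) (\<beta> e) xs - c * length xs))" for xs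
      by (simp add: H_def exp_add[symmetric] algebra_simps)
    have fresh: "b (hd xs) = \<beta>0 (hd xs)" if "hd xs \<notin> set (tl xs)"
      using that Suc.prems(3) unfolding unvisited_initial_def fst_conv snd_conv by blast
    show ?thesis
      unfolding split using mult_left_mono[OF super[where e=e and xs=xs and b=b, OF e Suc.prems(1,2) fresh], of "exp (\<theta> e * (\<kappa> e + \<beta> e * L))"]
      by simp
  qed
  have step: "1 - (\<Sum>e\<in>{e1, e2}. H e (fst s)) \<le> measure_pmf.prob (trace_after p \<phi> \<psi> n s) ?A"
    if supp: "s \<in> set_pmf ?M" for s
  proof -
    obtain a y where y: "y \<in> set_pmf (p (hd xs) a)"
      and s: "s = (y # xs, env_update \<psi> b (hd xs) a y)"
      using supp unfolding set_trace_step by blast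
    then obtain d where d: "d \<in> unit_steps" "y = hd xs + d"
      using set_transition[OF xq] by blast
    note lb = line_bound_step[OF Suc.prems(4) norm_l Suc.prems(1,2) d(1), folded d(2)]
    show ?thesis
    proof (cases "y \<in> S (length xs)")
      case True
      have "y \<in> interior_sites"
      proof (rule coordinate_pos_interior)
        fix e assume e: "e \<in> {e1, e2}"
        have "\<kappa> e + c * (real (length xs) + 1) \<le> to_plane y \<bullet> to_plane e"
          using True e unfolding S[OF Suc.prems(5)] by blast
        moreover have "c * (real N + 1) \<le> c * (real (length xs) + 1)"
          using c Suc.prems(5) by (intro mult_left_mono) auto
        ultimately show "0 < to_plane y \<bullet> to_plane e" using pos[OF e] by linarith
      qed
      moreover have "unvisited_initial s"
        using unvisited_initial_step[OF Suc.prems(3) _ supp] Suc.prems(1) by simp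
      ultimately show ?thesis
        using Suc.IH[of "y # xs" "env_update \<psi> b (hd xs) a y"] True lb(2) Suc.prems(5,6)
        unfolding s H_def by simp
    next
      case False
      then obtain e where e: "e \<in> {e1, e2}" "to_plane y \<bullet> to_plane e < \<kappa> e + c * (real (length xs) + 1)"
        unfolding S[OF Suc.prems(5)] mem_Collect_eq by (meson not_le)
      have "\<beta> e * (to_plane y \<bullet> l - L) \<le> \<beta> e * card (set xs \<inter> interior_sites)"
        using lb(1) beta_nonneg[OF e(1)] by (intro mult_left_mono)
      then have "potential (dir e) (\<beta> e) (y # xs) \<le> to_plane y \<bullet> to_plane e + \<beta> e * L"
        by (simp add: potential_def dir_def inner_add_right algebra_simps)
      then have "potential (dir e) (\<beta> e) (y # xs) - c * length (y # xs) - (\<kappa> e + \<beta> e * L) \<le> 0"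
        using e(2) by (simp add: algebra_simps)
      then have "1 \<le> H e (fst s)"
        using \<theta>[OF e(1)] unfolding H_def s by (simp add: mult_le_0_iff)
      also have "\<dots> \<le> (\<Sum>e\<in>{e1, e2}. H e (fst s))"
        using e(1) by (intro member_le_sum) (auto simp: H_def)
      finally have "1 - (\<Sum>e\<in>{e1, e2}. H e (fst s)) \<le> 0" by simp
      then show ?thesis using measure_nonneg order_trans by blast
    qed
  qed
  have "1 - (\<Sum>e\<in>{e1, e2}. H e xs) \<le> 1 - (\<Sum>e\<in>{e1, e2}. measure_pmf.expectation ?M (\<lambda>s. H e (fst s)))"
    using H_super by (intro diff_left_mono sum_mono) auto
  also have "\<dots> = measure_pmf.expectation ?M (\<lambda>s. 1 - (\<Sum>e\<in>{e1, e2}. H e (fst s)))"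
    using int by (subst Bochner_Integration.integral_diff) (auto simp: Bochner_Integration.integral_sum)
  also have "\<dots> \<le> measure_pmf.expectation ?M (\<lambda>s. measure_pmf.prob (trace_after p \<phi> \<psi> n s) ?A)"
    using step by (intro integral_mono_AE int AE_pmfI)
  also have "\<dots> = measure_pmf.prob (trace_after p \<phi> \<psi> (Suc n) (xs, b)) ?A"
    by (simp add: prob_bind_pmf)
  finally show ?case by (simp add: H_def)
qed

end

section \<open>Climbing a staircase of fresh sites\<close>

text \<open>Before time \<open>m\<close>, when the interior is entered at \<open>y\<close>, nothing is required. The slack \<open>C\<close> pays for
the time spent on the staircase.\<close>

definition escape_region :: "state \<Rightarrow> nat \<Rightarrow> real \<Rightarrow> real \<Rightarrow> nat \<Rightarrow> state set" where
  "escape_region y m c C k = (if k < m then UNIV else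
     {z. \<forall>e\<in>{e1, e2}. to_plane y \<bullet> to_plane e \<le> to_plane z \<bullet> to_plane e \<and>
            c * (real k - real m) - C \<le> to_plane z \<bullet> to_plane e})"

lemma forward_step_in_unit_steps: "e \<in> {e1, e2} \<Longrightarrow> e \<in> unit_steps"
  by (auto simp: unit_steps_def)

lemma to_plane_coordinates: "to_plane x \<bullet> to_plane e1 = fst x" "to_plane x \<bullet> to_plane e2 = snd x"
  by (simp_all add: to_plane_def e1_def e2_def)

context drifting_llp
begin

definition slope :: real where
  "slope = fst fresh_drift / (fst fresh_drift + snd fresh_drift)"

text \<open>The monotone lattice path that stays within bounded distance of the ray from \<open>y\<close> in the direction
of the drift at fresh sites.\<close>

definition stair :: "state \<Rightarrow> nat \<Rightarrow> state" where
  "stair y t = y + (\<lfloor>slope * t\<rfloor>, int t - \<lfloor>slope * t\<rfloor>)"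

primrec stairs :: "state list \<Rightarrow> nat \<Rightarrow> state list" where
  "stairs xs 0 = xs"
| "stairs xs (Suc t) = stair (hd xs) (Suc t) # stairs xs t"

lemma slope_bounds: "0 < slope" "slope < 1"
  using fresh_drift_pos by (simp_all add: slope_def add_pos_pos)

lemma stair_0: "stair y 0 = y"
  by (simp add: stair_def zero_prod_def[symmetric])

lemma stair_Suc: "\<exists>d\<in>{e1, e2}. stair y (Suc t) = stair y t + d"
proof -
  have "slope * t \<le> slope * Suc t" "slope * Suc t \<le> slope * t + 1"
    using slope_bounds by (auto simp: algebra_simps)
  then have "\<lfloor>slope * t\<rfloor> \<le> \<lfloor>slope * Suc t\<rfloor>" "\<lfloor>slope * Suc t\<rfloor> \<le> \<lfloor>slope * t\<rfloor> + 1"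
    by linarith+
  then consider "\<lfloor>slope * Suc t\<rfloor> = \<lfloor>slope * t\<rfloor>" | "\<lfloor>slope * Suc t\<rfloor> = \<lfloor>slope * t\<rfloor> + 1"
    by linarith
  then show ?thesis
    by cases (cases y; simp add: stair_def e1_def e2_def del: of_nat_Suc)+
qed

lemma stair_sum: "fst (stair y t) + snd (stair y t) = fst y + snd y + int t"
  by (simp add: stair_def)

lemma stair_inj: "inj (stair y)"
proof (rule injI)
  fix s t assume eq: "stair y s = stair y t"
  have "fst y + snd y + int s = fst y + snd y + int t"
    unfolding stair_sum[symmetric] eq by (rule refl)
  then show "s = t" by simp
qed

lemma stair_ge: "fst y \<le> fst (stair y t)" "snd y \<le> snd (stair y t)"
proof -
  have "0 \<le> slope * t" using slope_bounds by simp
  moreover have "slope * t \<le> 1 * real t"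
    using slope_bounds by (intro mult_right_mono) simp_all
  ultimately have "0 \<le> \<lfloor>slope * t\<rfloor>" "\<lfloor>slope * t\<rfloor> \<le> int t" by linarith+
  then show "fst y \<le> fst (stair y t)" "snd y \<le> snd (stair y t)"
    by (simp_all add: stair_def)
qed

lemma stair_interior: "y \<in> interior_sites \<Longrightarrow> stair y t \<in> interior_sites"
  using stair_ge[of y t] by (auto simp: interior_sites_def)

lemma fresh_drift_sum: "fst fresh_drift + snd fresh_drift \<le> 1"
proof -
  have "fresh_prob * (fst (drift (\<mu> Act_r)) + snd (drift (\<mu> Act_r))) +
      (1 - fresh_prob) * (fst (drift (\<mu> Act_g)) + snd (drift (\<mu> Act_g))) \<le> fresh_prob * 1 + (1 - fresh_prob) * 1"
    using drift_sum_le mu_step_dist fresh_prob_bounds by (intro add_mono mult_left_mono) auto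
  then show ?thesis by (simp add: fresh_drift_def algebra_simps)
qed

text \<open>By \<open>fresh_gain\<close> the drift vector at fresh sites has inner product at least \<open>\<beta> e + \<eta>\<close> with \<open>dir e\<close>.
Its coordinates are positive with sum at most \<open>1\<close>, while those of a staircase step have sum \<open>1\<close>; so the
staircase gains on average at least as much per step. The term \<open>2 * norm (dir e)\<close> is the rounding error.\<close>

lemma stair_gain:
  assumes e: "e \<in> {e1, e2}"
  shows "to_plane y \<bullet> dir e + t * (\<beta> e + \<eta>) - 2 * norm (dir e) \<le> to_plane (stair y t) \<bullet> dir e"
proof -
  \<comment> \<open>The path differs from the ray by \<open>\<delta>\<close> times \<open>(- 1, 1)\<close>, with \<open>\<delta>\<close> the rounding error.\<close>
  define \<delta> where "\<delta> = slope * t - \<lfloor>slope * t\<rfloor>"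
  define s where "s = fst fresh_drift + snd fresh_drift"
  have s: "0 < s" "s \<le> 1" using fresh_drift_pos fresh_drift_sum by (simp_all add: s_def)
  have dir: "(slope, 1 - slope) = fresh_drift /\<^sub>R s"
    using s by (auto simp: slope_def s_def prod_eq_iff field_simps)
  have gain: "\<beta> e + \<eta> \<le> fresh_drift \<bullet> dir e" using fresh_gain[OF e] by (simp add: dir_def)
  also have "\<dots> \<le> (fresh_drift \<bullet> dir e) / s"
    using s gain beta_nonneg[OF e] eta_pos
    by (subst pos_le_divide_eq) (auto intro!: mult_right_le_one_le)
  also have "\<dots> = (slope, 1 - slope) \<bullet> dir e"
    unfolding dir by (simp add: divide_inverse mult.commute)
  finally have 1: "t * (\<beta> e + \<eta>) \<le> t * ((slope, 1 - slope) \<bullet> dir e)"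
    by (intro mult_left_mono) auto
  have "norm (\<delta> *\<^sub>R (- 1, 1) :: real \<times> real) \<le> 1 * 2"
  proof -
    have "\<bar>\<delta>\<bar> \<le> 1" unfolding \<delta>_def by linarith
    moreover have "norm (- 1 :: real, 1 :: real) \<le> 2"
      by (simp add: norm_prod_def real_le_lsqrt)
    ultimately show ?thesis unfolding norm_scaleR by (intro mult_mono) auto
  qed
  then have "norm (\<delta> *\<^sub>R (- 1, 1) :: real \<times> real) * norm (dir e) \<le> 2 * norm (dir e)"
    by (intro mult_right_mono) auto
  then have 2: "\<bar>(\<delta> *\<^sub>R (- 1, 1)) \<bullet> dir e\<bar> \<le> 2 * norm (dir e)"
    using Cauchy_Schwarz_ineq2[of "\<delta> *\<^sub>R (- 1, 1)" "dir e"] by linarith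
  have "to_plane (stair y t) = to_plane y + t *\<^sub>R (slope, 1 - slope) + \<delta> *\<^sub>R (- 1, 1)"
    by (simp add: stair_def to_plane_def \<delta>_def algebra_simps)
  then have "to_plane (stair y t) \<bullet> dir e =
      to_plane y \<bullet> dir e + t * ((slope, 1 - slope) \<bullet> dir e) + (\<delta> *\<^sub>R (- 1, 1)) \<bullet> dir e"
    by (simp only: inner_add_left inner_scaleR_left)
  then show ?thesis using 1 2 by linarith
qed

text \<open>The drift at fresh sites has positive coordinates, so each forward step is possible under some action.
On the staircase every site is fresh and admits every action; its forward steps thus have positive
probability.\<close>

lemma possible_step:
  assumes x: "x \<in> interior_sites" and d: "d \<in> {e1, e2}"
  shows "\<exists>a. x + d \<in> set_pmf (p x a)"
proof -
  have "\<exists>a. 0 < pmf (\<mu> a) d"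
  proof (rule ccontr)
    assume "\<not> ?thesis"
    then have zero: "pmf (\<mu> a) d = 0" for a
      using pmf_nonneg[of "\<mu> a" d] by (metis less_eq_real_def)
    have le: "fresh_prob * s + (1 - fresh_prob) * t \<le> 0" if "s \<le> 0" "t \<le> 0" for s t :: real
      using that fresh_prob_bounds by (intro add_nonpos_nonpos mult_nonneg_nonpos) auto
    show False
    proof (cases "d = e1")
      case True
      then show ?thesis
        using fresh_drift_pos(1) True zero le[of "- pmf (\<mu> Act_r) (- e1)" "- pmf (\<mu> Act_g) (- e1)"]
        by (simp add: drift_def fresh_drift_def)
    next
      case False
      then have "d = e2" using d by simp
      then show ?thesis
        using fresh_drift_pos(2) \<open>d = e2\<close> zero le[of "- pmf (\<mu> Act_r) (- e2)" "- pmf (\<mu> Act_g) (- e2)"]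
        by (simp add: drift_def fresh_drift_def)
    qed
  qed
  then obtain a where "0 < pmf (\<mu> a) d" by blast
  then show ?thesis
    using pmf_transition(1)[OF forward_step_in_unit_steps[OF d] x] by (auto simp: set_pmf_iff intro!: exI[of _ a])
qed

context
  fixes xs :: "state list" and b :: env
  assumes xs: "xs \<noteq> []" "hd xs \<in> interior_sites" "set (tl xs) \<inter> interior_sites = {}"
    and fresh: "unvisited_initial (xs, b)"
begin

lemma stairs_basic:
  "stairs xs t \<noteq> []" "length (stairs xs t) = length xs + t" "hd (stairs xs t) = stair (hd xs) t"
proof -
  show "stairs xs t \<noteq> []" using xs(1) by (cases t) simp_all
  show "length (stairs xs t) = length xs + t" by (induction t) simp_all
  show "hd (stairs xs t) = stair (hd xs) t" by (cases t) (simp_all add: stair_0)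
qed

lemma set_stairs: "set (stairs xs t) \<inter> interior_sites = stair (hd xs) ` {..t}"
proof (induction t)
  case 0
  have "set xs = insert (hd xs) (set (tl xs))" using xs by (cases xs) auto
  then show ?case using xs by (auto simp: stair_0)
next
  case (Suc t)
  then show ?case using stair_interior[OF xs(2)] by (simp add: atMost_Suc)
qed

lemma set_tl_stairs: "set (tl (stairs xs t)) \<inter> interior_sites = stair (hd xs) ` {..<t}"
proof (cases t)
  case 0
  then show ?thesis using xs by simp
next
  case (Suc t')
  then show ?thesis using set_stairs by (simp add: lessThan_Suc_atMost)
qed

lemma line_bound_stairs: "line_bound l (to_plane (hd xs) \<bullet> l) (stairs xs t)"
proof (induction t)
  case 0
  show ?case using set_stairs[of 0] by (simp add: line_bound_def stair_0)
next
  case (Suc t)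
  obtain d where d: "d \<in> {e1, e2}" "stair (hd xs) (Suc t) = stair (hd xs) t + d"
    using stair_Suc by blast
  then show ?case
    using line_bound_step(2)[OF Suc norm_l _ _ forward_step_in_unit_steps[OF d(1)]] stairs_basic(1,3)
      stair_interior[OF xs(2)] by simp
qed

lemma stairs_possible:
  "\<exists>b'. (stairs xs t, b') \<in> set_pmf (trace_after p \<phi> \<psi> t (xs, b)) \<and> unvisited_initial (stairs xs t, b')"
proof (induction t)
  case 0
  then show ?case using fresh by simp
next
  case (Suc t)
  then obtain b' where b': "(stairs xs t, b') \<in> set_pmf (trace_after p \<phi> \<psi> t (xs, b))"
    "unvisited_initial (stairs xs t, b')" by blast
  obtain d where d: "d \<in> {e1, e2}" "stair (hd xs) (Suc t) = stair (hd xs) t + d"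
    using stair_Suc by blast
  let ?x = "stair (hd xs) t"
  have x: "?x \<in> interior_sites" by (rule stair_interior[OF xs(2)])
  obtain a where a: "?x + d \<in> set_pmf (p ?x a)" using possible_step[OF x d(1)] by blast
  have "?x \<notin> set (tl (stairs xs t))"
    using set_tl_stairs[of t] x stair_inj[of "hd xs"] by (auto dest: injD)
  then have eq: "b' ?x = \<beta>0 ?x" using b'(2) unfolding unvisited_initial_def fst_conv snd_conv by blast
  have xq: "?x \<in> quadrant" using x interior_sites_subset by (rule subsetD[rotated])
  have "a \<in> set_pmf (\<phi> (b' ?x))" unfolding eq by (rule fresh_action_possible[OF xq])
  then have step: "(stairs xs (Suc t), env_update \<psi> b' ?x a (?x + d)) \<in> set_pmf (trace_step p \<phi> \<psi> (stairs xs t, b'))"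
    using a unfolding set_trace_step stairs_basic stairs.simps d(2) by blast
  then have "(stairs xs (Suc t), env_update \<psi> b' ?x a (?x + d)) \<in> set_pmf (trace_after p \<phi> \<psi> (Suc t) (xs, b))"
    using b'(1) unfolding trace_after_Suc_right set_bind_pmf by blast
  moreover have "unvisited_initial (stairs xs (Suc t), env_update \<psi> b' ?x a (?x + d))"
    using unvisited_initial_step[OF b'(2) _ step] stairs_basic by simp
  ultimately show ?case by blast
qed

lemma potential_stairs:
  assumes e: "e \<in> {e1, e2}"
  shows "to_plane (hd xs) \<bullet> dir e + t * \<eta> - 2 * norm (dir e) \<le> potential (dir e) (\<beta> e) (stairs xs t)"
proof -
  have "card (set (tl (stairs xs t)) \<inter> interior_sites) = t"
    unfolding set_tl_stairs using stair_inj[of "hd xs"] by (subst card_image) (auto intro: inj_on_subset)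
  then show ?thesis
    using stair_gain[OF e, of "hd xs" t] by (simp add: potential_def stairs_basic algebra_simps)
qed

lemma follows_stairs:
  assumes len: "length xs = Suc m" and c: "0 \<le> c" and C: "c * T \<le> C" and t: "t \<le> T"
  shows "follows (escape_region (hd xs) m c C) (stairs xs t)"
proof -
  have stair_mem: "stair (hd xs) t \<in> escape_region (hd xs) m c C (m + t)" if "t \<le> T" for t
  proof -
    have "c * t \<le> c * T" using that c by (intro mult_left_mono) simp_all
    then have ct: "c * t - C \<le> 0" using C by linarith
    have y: "0 < fst (hd xs)" "0 < snd (hd xs)"
      using xs(2) by (auto simp: interior_sites_def)
    have "\<forall>e\<in>{e1, e2}. to_plane (hd xs) \<bullet> to_plane e \<le> to_plane (stair (hd xs) t) \<bullet> to_plane e \<and>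
        0 \<le> to_plane (stair (hd xs) t) \<bullet> to_plane e"
      using stair_ge[of "hd xs" t] y by (simp add: to_plane_coordinates)
    moreover have "c * (real (m + t) - real m) - C \<le> 0" using ct by simp
    moreover have "\<not> m + t < m" by simp
    ultimately show ?thesis
      by (simp only: escape_region_def if_False mem_Collect_eq) (blast intro: order_trans)
  qed
  have early: "follows (escape_region (hd xs) m c C) ys" if "length ys \<le> m" for ys
    using that by (induction ys) (simp_all add: escape_region_def)
  show ?thesis
    using t
  proof (induction t)
    case 0
    show ?case
      using early[of "tl xs"] stair_mem[of 0] xs(1) len by (cases xs) (simp_all add: stair_0)
  next
    case (Suc t)
    then show ?case using stair_mem[of "Suc t"] stairs_basic(2)[of t] len by simp
  qed
qed

text \<open>The staircase of length \<open>T\<close> raises the potentials by \<open>T * \<eta>\<close> up to a constant, while the region to be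
followed afterwards starts from \<open>y\<close> again. So a large \<open>T\<close> makes the exponential bound of
\<open>prob_follows_ge\<close> smaller than \<open>1\<close> (namely at most \<open>2 / e\<close>), and the staircase itself has positive
probability.\<close>

lemma escape_probability:
  assumes len: "length xs = Suc m"
  shows "\<exists>C T. \<exists>\<epsilon>>0. \<forall>n. \<epsilon> \<le> measure_pmf.prob (trace_after p \<phi> \<psi> (T + n) (xs, b))
           {s. follows (escape_region (hd xs) m (\<eta> / 2) C) (fst s)}"
proof -
  define c where "c = \<eta> / 2"
  have c: "0 < c" "0 \<le> c" "c < \<eta>" using eta_pos by (auto simp: c_def)
  let ?y = "hd xs"
  define P where "P e \<theta> \<longleftrightarrow> 0 < \<theta> \<and> (\<forall>xs b. xs \<noteq> [] \<and> hd xs \<in> interior_sites \<and>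
      (hd xs \<notin> set (tl xs) \<longrightarrow> b (hd xs) = \<beta>0 (hd xs)) \<longrightarrow>
      measure_pmf.expectation (trace_step p \<phi> \<psi> (xs, b))
        (\<lambda>s. exp (- \<theta> * (potential (dir e) (\<beta> e) (fst s) - c * length (fst s)))) \<le>
      exp (- \<theta> * (potential (dir e) (\<beta> e) xs - c * length xs)))" for e \<theta>
  have "\<forall>e\<in>{e1, e2}. \<exists>\<theta>. P e \<theta>"
    using exp_potential_supermartingale[OF c(2,3)] unfolding P_def by blast
  then obtain \<theta> where \<theta>P: "\<forall>e\<in>{e1, e2}. P e (\<theta> e)"
    using bchoice[of "{e1, e2}" P] by blast
  have \<theta>: "0 < \<theta> e" if "e \<in> {e1, e2}" for e
    using \<theta>P that unfolding P_def by blast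
  have super: "measure_pmf.expectation (trace_step p \<phi> \<psi> (xs, b))
        (\<lambda>s. exp (- \<theta> e * (potential (dir e) (\<beta> e) (fst s) - c * length (fst s)))) \<le>
      exp (- \<theta> e * (potential (dir e) (\<beta> e) xs - c * length xs))"
    if "e \<in> {e1, e2}" "xs \<noteq> []" "hd xs \<in> interior_sites"
      "hd xs \<notin> set (tl xs) \<Longrightarrow> b (hd xs) = \<beta>0 (hd xs)" for e xs b
    using \<theta>P that unfolding P_def by blast
  obtain T :: nat where T: "\<And>e. e \<in> {e1, e2} \<Longrightarrow> 1 \<le> \<theta> e * (T * \<eta> - 2 * norm (dir e))"
  proof -
    have "\<exists>T::nat. \<forall>T'::nat. T \<le> T' \<longrightarrow> 1 \<le> \<theta> e * (real T' * \<eta> - 2 * norm (dir e))" if e: "e \<in> {e1, e2}" for e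
    proof -
      obtain T :: nat where "(1 / \<theta> e + 2 * norm (dir e)) / \<eta> \<le> T"
        using real_arch_simple by blast
      then have T: "1 / \<theta> e + 2 * norm (dir e) \<le> T * \<eta>"
        using eta_pos by (simp add: pos_divide_le_eq)
      have "1 / \<theta> e \<le> T' * \<eta> - 2 * norm (dir e)" if "T' \<ge> T" for T' :: nat
      proof -
        have "real T * \<eta> \<le> real T' * \<eta>"
          using that eta_pos by (intro mult_right_mono) simp_all
        with T show ?thesis by linarith
      qed
      then have "1 \<le> \<theta> e * (real T' * \<eta> - 2 * norm (dir e))" if "T' \<ge> T" for T' :: nat
        using that \<theta>[OF e] by (simp add: pos_divide_le_eq mult.commute)
      then show ?thesis by blast
    qed
    from this[of e1] this[of e2] obtain T1 T2 :: nat where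
      "\<forall>T'::nat. T1 \<le> T' \<longrightarrow> 1 \<le> \<theta> e1 * (real T' * \<eta> - 2 * norm (dir e1))"
      "\<forall>T'::nat. T2 \<le> T' \<longrightarrow> 1 \<le> \<theta> e2 * (real T' * \<eta> - 2 * norm (dir e2))" by auto
    then show ?thesis by (intro that[of "max T1 T2"]) auto
  qed
  \<comment> \<open>\<open>N\<close> is the number of sites on the trace when the staircase ends; \<open>\<kappa>\<close> is chosen such that the
    requirement for the next site is to lie above \<open>y\<close>, so that the time spent on the staircase costs
    nothing.\<close>
  define N where "N = Suc m + T"
  define \<kappa> where "\<kappa> e = to_plane ?y \<bullet> to_plane e - c * (real N + 1)" for e
  define C where "C = c * (T + 1)"
  define S where "S k = (if k < N then escape_region ?y m c C k
     else {z. \<forall>e\<in>{e1, e2}. \<kappa> e + c * (real k + 1) \<le> to_plane z \<bullet> to_plane e})" for k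
  let ?st = "stairs xs T"
  obtain b' where b': "(?st, b') \<in> set_pmf (trace_after p \<phi> \<psi> T (xs, b))" "unvisited_initial (?st, b')"
    using stairs_possible by blast
  have len_st: "length ?st = N" using stairs_basic(2) len by (simp add: N_def)
  have pos: "0 < \<kappa> e + c * (real N + 1)" if "e \<in> {e1, e2}" for e
    using that xs(2) by (auto simp: \<kappa>_def to_plane_coordinates interior_sites_def)
  have "follows S ?st"
  proof (rule follows_mono)
    show "follows (escape_region ?y m c C) ?st"
      using c by (intro follows_stairs[OF len, where T=T]) (auto simp: C_def)
  qed (simp add: S_def len_st)
  then have survive: "1 - (\<Sum>e\<in>{e1, e2}. exp (- \<theta> e * (potential (dir e) (\<beta> e) ?st - c * length ?st
        - (\<kappa> e + \<beta> e * (to_plane ?y \<bullet> l)))))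
      \<le> measure_pmf.prob (trace_after p \<phi> \<psi> n (?st, b')) {s. follows S (fst s)}" for n
    using stairs_basic(1,3) stair_interior[OF xs(2)] b'(2) line_bound_stairs len_st
    by (intro prob_follows_ge[OF c(2) \<theta> super, where N=N and \<kappa>=\<kappa>]) (auto simp: S_def pos)
  define g where "g = 1 - 2 * exp (- 1 :: real)"
  have g: "0 < g" using exp_lower_Taylor_quadratic[of "1::real"] by (simp add: g_def exp_minus field_simps)
  have small: "exp (- \<theta> e * (potential (dir e) (\<beta> e) ?st - c * length ?st
        - (\<kappa> e + \<beta> e * (to_plane ?y \<bullet> l)))) \<le> exp (- 1)" if e: "e \<in> {e1, e2}" for e
  proof -
    have "T * \<eta> - 2 * norm (dir e) \<le> potential (dir e) (\<beta> e) ?st - c * length ?st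
        - (\<kappa> e + \<beta> e * (to_plane ?y \<bullet> l))"
      using potential_stairs[OF e, of T] c(1) unfolding len_st \<kappa>_def
      by (simp add: dir_def inner_add_right algebra_simps)
    then have "1 \<le> \<theta> e * (potential (dir e) (\<beta> e) ?st - c * length ?st
        - (\<kappa> e + \<beta> e * (to_plane ?y \<bullet> l)))"
      using \<theta>[OF e] by (intro order_trans[OF T[OF e]] mult_left_mono) simp_all
    then show ?thesis by simp
  qed
  have S_sub: "S k \<subseteq> escape_region ?y m c C k" for k
  proof (cases "k < N")
    case False
    have "z \<in> escape_region ?y m c C k" if z: "z \<in> S k" for z
    proof -
      have *: "to_plane ?y \<bullet> to_plane e + c * (real k - real N) \<le> to_plane z \<bullet> to_plane e"
        if "e \<in> {e1, e2}" for e
        using z that False by (auto simp: S_def \<kappa>_def algebra_simps)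
      have kN: "0 \<le> c * (real k - real N)" using False c by simp
      have km: "c * (real k - real m) - C = c * (real k - real N)"
        by (simp add: C_def N_def algebra_simps)
      have y: "0 \<le> to_plane ?y \<bullet> to_plane e" if "e \<in> {e1, e2}" for e
        using that xs(2) by (auto simp: to_plane_coordinates interior_sites_def)
      have "to_plane ?y \<bullet> to_plane e \<le> to_plane z \<bullet> to_plane e \<and>
          c * (real k - real m) - C \<le> to_plane z \<bullet> to_plane e" if "e \<in> {e1, e2}" for e
        using *[OF that] y[OF that] kN km by linarith
      then show ?thesis unfolding escape_region_def by auto
    qed
    then show ?thesis by blast
  qed (simp add: S_def)
  let ?pr = "pmf (trace_after p \<phi> \<psi> T (xs, b)) (?st, b')"
  have "?pr * g \<le> measure_pmf.prob (trace_after p \<phi> \<psi> (T + n) (xs, b))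
           {s. follows (escape_region ?y m c C) (fst s)}" for n
  proof -
    have "(\<Sum>e\<in>{e1, e2}. exp (- \<theta> e * (potential (dir e) (\<beta> e) ?st - c * length ?st
        - (\<kappa> e + \<beta> e * (to_plane ?y \<bullet> l))))) \<le> (\<Sum>e\<in>{e1, e2}. exp (- 1))"
      using small by (intro sum_mono)
    also have "\<dots> = 2 * exp (- 1)" by (simp add: e1_def e2_def)
    finally have "g \<le> measure_pmf.prob (trace_after p \<phi> \<psi> n (?st, b')) {s. follows S (fst s)}"
      using survive[of n] by (simp add: g_def)
    also have "\<dots> \<le> measure_pmf.prob (trace_after p \<phi> \<psi> n (?st, b')) {s. follows (escape_region ?y m c C) (fst s)}"
      by (intro measure_pmf.finite_measure_mono) (auto intro: follows_mono[OF _ S_sub])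
    finally have "?pr * g \<le> ?pr * measure_pmf.prob (trace_after p \<phi> \<psi> n (?st, b'))
        {s. follows (escape_region ?y m c C) (fst s)}"
      by (intro mult_left_mono) auto
    also have "\<dots> \<le> measure_pmf.prob (trace_after p \<phi> \<psi> (T + n) (xs, b))
        {s. follows (escape_region ?y m c C) (fst s)}"
      unfolding trace_after_add by (rule prob_bind_pmf_ge)
    finally show ?thesis .
  qed
  moreover have "0 < ?pr * g" using b'(1) g by (simp add: pmf_positive)
  ultimately show ?thesis unfolding c_def by blast
qed

end

end

section \<open>Events of the state process\<close>

definition size_of :: "state \<Rightarrow> real" where
  "size_of x = of_int (fst x + snd x)"

lemma cost_eq_size_diff: "cost x a y = size_of y - size_of x"
  by (simp add: cost_def size_of_def)

lemma measurable_llp_X: "(\<lambda>\<omega>. f (llp_X n \<omega>)) \<in> measurable (llp_law p \<phi> \<psi> \<beta>0 x0) (count_space UNIV)"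
proof -
  have "(\<lambda>\<omega>. f (fst (\<omega> n))) \<in> measurable (PiM UNIV (\<lambda>_. count_space UNIV)) (count_space UNIV)"
    by (rule measurable_compose[OF measurable_component_singleton]) auto
  then show ?thesis
    using measurable_cong_sets[OF sets_llp_law refl] unfolding llp_X_def by blast
qed

lemma sets_llp_X: "{\<omega>. P (llp_X n \<omega>)} \<in> sets (llp_law p \<phi> \<psi> \<beta>0 x0)"
proof -
  have "{\<omega>. P (llp_X n \<omega>)} = (\<lambda>\<omega>. P (llp_X n \<omega>)) -` {True} \<inter> space (llp_law p \<phi> \<psi> \<beta>0 x0)"
    by (auto simp: space_llp_law)
  then show ?thesis using measurable_sets[OF measurable_llp_X] by (metis UNIV_I sets_count_space Pow_UNIV)
qed

lemma borel_measurable_llp_X [measurable]: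
  fixes f :: "state \<Rightarrow> real"
  shows "(\<lambda>\<omega>. f (llp_X n \<omega>)) \<in> borel_measurable (llp_law p \<phi> \<psi> \<beta>0 x0)"
  using measurable_compose[OF measurable_llp_X[where f="\<lambda>x. x"], where g=f and L=borel] by simp

lemma return_time_infinite_iff: "return_time U \<omega> = \<infinity> \<longleftrightarrow> (\<forall>n\<ge>1. llp_X n \<omega> \<notin> U)"
proof
  assume inf: "return_time U \<omega> = \<infinity>"
  show "\<forall>n\<ge>1. llp_X n \<omega> \<notin> U"
  proof (intro allI impI notI)
    fix n :: nat assume "1 \<le> n" "llp_X n \<omega> \<in> U"
    then have "return_time U \<omega> \<le> enat n"
      unfolding return_time_def by (intro INF_lower) simp
    then show False using inf by simp
  qed
next
  assume "\<forall>n\<ge>1. llp_X n \<omega> \<notin> U"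
  then have empty: "{n. 1 \<le> n \<and> llp_X n \<omega> \<in> U} = {}" by blast
  show "return_time U \<omega> = \<infinity>"
    unfolding return_time_def empty by (simp add: top_enat_def)
qed

context quadrant_llp
begin

text \<open>A walk that starts on an axis must leave the axes in order to hit the state \<open>(1, 1)\<close>, as it does
with positive probability by irreducibility. At the first entrance into the interior all sites visited
before are on the axes.\<close>

lemma interior_entrance:
  assumes irr: "llp_irreducible p \<phi> \<psi> \<beta>0" and x: "x \<in> quadrant"
  shows "\<exists>m xs b. (xs, b) \<in> set_pmf (trace_after p \<phi> \<psi> m ([x], \<beta>0)) \<and>
           hd xs \<in> interior_sites \<and> set (tl xs) \<inter> interior_sites = {}"
proof (rule ccontr)
  assume none: "\<not> ?thesis"
  have one: "(1, 1) \<in> interior_sites" by (simp add: interior_sites_def)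
  have "x \<notin> interior_sites"
  proof
    assume "x \<in> interior_sites"
    then have "([x], \<beta>0) \<in> set_pmf (trace_after p \<phi> \<psi> 0 ([x], \<beta>0)) \<and>
        hd [x] \<in> interior_sites \<and> set (tl [x]) \<inter> interior_sites = {}" by simp
    then show False using none by blast
  qed
  have axes: "s \<in> set_pmf (trace_after p \<phi> \<psi> n ([x], \<beta>0)) \<Longrightarrow> set (fst s) \<inter> interior_sites = {}" for n s
  proof (induction n arbitrary: s)
    case 0
    then show ?case using \<open>x \<notin> interior_sites\<close> by simp
  next
    case (Suc n)
    from Suc.prems obtain s0 where s0: "s0 \<in> set_pmf (trace_after p \<phi> \<psi> n ([x], \<beta>0))"
      and s: "s \<in> set_pmf (trace_step p \<phi> \<psi> s0)"
      unfolding trace_after_Suc_right set_bind_pmf by blast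
    obtain xs b where s0_eq: "s0 = (xs, b)" by (cases s0)
    obtain a y where s_eq: "s = (y # xs, env_update \<psi> b (hd xs) a y)"
      using s unfolding s0_eq set_trace_step by blast
    have tl: "set xs \<inter> interior_sites = {}" using Suc.IH[OF s0] s0_eq by simp
    have "y \<notin> interior_sites"
    proof
      assume "y \<in> interior_sites"
      then have "(y # xs, env_update \<psi> b (hd xs) a y) \<in> set_pmf (trace_after p \<phi> \<psi> (Suc n) ([x], \<beta>0)) \<and>
          hd (y # xs) \<in> interior_sites \<and> set (tl (y # xs)) \<inter> interior_sites = {}"
        using Suc.prems tl unfolding s_eq by simp
      then show False using none by blast
    qed
    then show ?case using tl by (simp add: s_eq)
  qed
  interpret L: prob_space "llp_law p \<phi> \<psi> \<beta>0 x" by (rule prob_space_llp_law)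
  have "AE \<omega> in llp_law p \<phi> \<psi> \<beta>0 x. llp_X n \<omega> \<notin> interior_sites" for n
  proof -
    have sub: "set_pmf (trace_after p \<phi> \<psi> n ([x], \<beta>0)) \<subseteq> {s. hd (fst s) \<notin> interior_sites}"
    proof
      fix s assume s: "s \<in> set_pmf (trace_after p \<phi> \<psi> n ([x], \<beta>0))"
      have "fst s \<noteq> []" using reachable_trace[OF s x] by auto
      then show "s \<in> {s. hd (fst s) \<notin> interior_sites}"
        using axes[OF s] hd_in_set[of "fst s"] by blast
    qed
    have "1 = measure_pmf.prob (trace_after p \<phi> \<psi> n ([x], \<beta>0)) {s. hd (fst s) \<notin> interior_sites}"
      using sub by (subst eq_commute, subst measure_pmf.prob_eq_1) (auto simp: AE_measure_pmf_iff subset_iff)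
    also have "\<dots> \<le> L.prob {\<omega>. llp_X n \<omega> \<notin> interior_sites}"
      using sets_llp_X[where P="\<lambda>z. z \<notin> interior_sites"] by (rule trace_le_law) simp
    finally have "L.prob {\<omega>. llp_X n \<omega> \<notin> interior_sites} = 1"
      using L.prob_le_1 by (simp add: antisym)
    then show ?thesis
      using L.prob_eq_1[OF sets_llp_X[where P="\<lambda>z. z \<notin> interior_sites"]] by simp
  qed
  then have "AE \<omega> in llp_law p \<phi> \<psi> \<beta>0 x. \<forall>n. llp_X n \<omega> \<notin> interior_sites"
    by (simp add: AE_all_countable)
  then have "AE \<omega> in llp_law p \<phi> \<psi> \<beta>0 x. \<not> return_time {(1, 1)} \<omega> < \<infinity>"
  proof eventually_elim
    case (elim \<omega>)
    then have "return_time {(1, 1)} \<omega> = \<infinity>"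
      unfolding return_time_infinite_iff using one by (metis singletonD)
    then show ?case by simp
  qed
  then have "L.prob {\<omega>\<in>space (llp_law p \<phi> \<psi> \<beta>0 x). return_time {(1, 1)} \<omega> < \<infinity>} = 0"
    by (rule L.prob_eq_0_AE)
  moreover have "0 < L.prob {\<omega>\<in>space (llp_law p \<phi> \<psi> \<beta>0 x). return_time {(1, 1)} \<omega> < \<infinity>}"
  proof -
    have "x \<in> quadrant - {(1, 1)}" using x \<open>x \<notin> interior_sites\<close> by (auto simp: interior_sites_def)
    moreover have "{(1, 1)} \<subseteq> quadrant" "bounded (to_plane ` {(1, 1)})" by (auto simp: quadrant_def)
    ultimately show ?thesis using irr unfolding llp_irreducible_def by blast
  qed
  ultimately show False by simp
qed

end

section \<open>Transience\<close>

context drifting_llp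
begin

text \<open>The staircase and the confinement region stay above the starting site in both coordinates, so it is
enough to start beyond the bounded set.\<close>

lemma avoids_bounded_set:
  assumes U: "U \<subseteq> quadrant" "bounded (to_plane ` U)"
  shows "\<exists>x0\<in>quadrant - U. 0 < \<P>(\<omega> in llp_law p \<phi> \<psi> \<beta>0 x0. return_time U \<omega> = \<infinity>)"
proof -
  obtain B where B: "\<And>z. z \<in> U \<Longrightarrow> norm (to_plane z) \<le> B"
    using U(2) unfolding bounded_iff by blast
  define M :: int where "M = \<lfloor>max B 0\<rfloor> + 1"
  define x0 :: state where "x0 = (M, M)"
  have M: "B < M" "1 \<le> M" unfolding M_def by linarith+
  have x0: "x0 \<in> interior_sites" using M by (simp add: x0_def interior_sites_def)
  have far: "z \<notin> U" if "to_plane x0 \<bullet> to_plane e1 \<le> to_plane z \<bullet> to_plane e1" for z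
  proof
    assume "z \<in> U"
    have "real_of_int (fst z) \<le> norm (to_plane z)"
      using norm_fst_le[of "of_int (fst z) :: real" "of_int (snd z) :: real"]
      by (simp add: to_plane_def)
    then show False using B[OF \<open>z \<in> U\<close>] M that by (simp add: to_plane_coordinates x0_def)
  qed
  have fresh: "unvisited_initial ([x0], \<beta>0)" by (simp add: unvisited_initial_def)
  obtain C T \<epsilon> where \<epsilon>: "0 < \<epsilon>" and esc: "\<And>n. \<epsilon> \<le> measure_pmf.prob (trace_after p \<phi> \<psi> (T + n) ([x0], \<beta>0))
      {s. follows (escape_region x0 0 (\<eta> / 2) C) (fst s)}"
    using escape_probability[of "[x0]" \<beta>0 0] x0 fresh by auto
  interpret L: prob_space "llp_law p \<phi> \<psi> \<beta>0 x0" by (rule prob_space_llp_law)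
  define E where "E n = (\<Inter>k\<in>{1..Suc n}. {\<omega>. llp_X k \<omega> \<notin> U})" for n
  have E_sets: "E n \<in> sets (llp_law p \<phi> \<psi> \<beta>0 x0)" for n
    unfolding E_def by (intro sets.finite_INT sets_llp_X[where P="\<lambda>z. z \<notin> U"]) auto
  have E_prob: "\<epsilon> \<le> L.prob (E n)" for n
  proof -
    have "measure_pmf.prob (trace_after p \<phi> \<psi> (T + Suc n) ([x0], \<beta>0))
        {s. follows (escape_region x0 0 (\<eta> / 2) C) (fst s)} \<le> L.prob (E n)"
    proof (rule trace_le_law[OF E_sets])
      fix \<omega> assume "follows (escape_region x0 0 (\<eta> / 2) C) (map (\<lambda>i. llp_X i \<omega>) (rev [0..<Suc (T + Suc n)]))"
      then have "llp_X k \<omega> \<in> escape_region x0 0 (\<eta> / 2) C k" if "k \<le> Suc n" for k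
        unfolding follows_map_rev using that by simp
      then have "llp_X k \<omega> \<notin> U" if "k \<le> Suc n" for k
        using that far unfolding escape_region_def by auto
      then show "\<omega> \<in> E n" by (auto simp: E_def)
    qed
    then show ?thesis using esc[of "Suc n"] by linarith
  qed
  have "(\<lambda>n. L.prob (E n)) \<longlonglongrightarrow> L.prob (\<Inter>n. E n)"
    using E_sets by (intro L.finite_Lim_measure_decseq) (auto simp: decseq_def E_def)
  then have "\<epsilon> \<le> L.prob (\<Inter>n. E n)"
    using E_prob by (intro LIMSEQ_le_const) auto
  moreover have "(\<Inter>n. E n) = {\<omega> \<in> space (llp_law p \<phi> \<psi> \<beta>0 x0). return_time U \<omega> = \<infinity>}"
  proof -
    have "(\<forall>n. \<forall>k\<in>{1..Suc n}. llp_X k \<omega> \<notin> U) \<longleftrightarrow> (\<forall>n\<ge>1. llp_X n \<omega> \<notin> U)" for \<omega>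
      by (meson atLeastAtMost_iff le_SucI order_refl)
    then show ?thesis by (auto simp: E_def return_time_infinite_iff space_llp_law)
  qed
  ultimately have "0 < \<P>(\<omega> in llp_law p \<phi> \<psi> \<beta>0 x0. return_time U \<omega> = \<infinity>)"
    using \<epsilon> by simp
  moreover have "x0 \<in> quadrant - U" using x0 far interior_sites_subset by blast
  ultimately show ?thesis by blast
qed

end

section \<open>Discounted cost\<close>

text \<open>The deviation \<open>t i = s i - a * i + B\<close> is nonnegative, and summation by parts shows that the
discounted sum of its increments is at least \<open>- t 0\<close>. So the discounted sum for \<open>s\<close> is at least
\<open>a / (1 - \<gamma>) - t 0\<close>, and half of the main term absorbs the constant when \<open>\<gamma>\<close> is close to \<open>1\<close>.\<close>

lemma discounted_increments_order:
  fixes s :: "nat \<Rightarrow> real"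
  assumes incr: "\<And>i. s (Suc i) - s i \<le> 1" and a: "0 < a" and lower: "\<And>i. a * i - B \<le> s i"
  shows "\<exists>k>0. \<exists>K>0. \<exists>\<epsilon>>0. \<forall>\<gamma>\<in>{1 - \<epsilon><..<1}.
    ereal (k / (1 - \<gamma>)) \<le> limsup (\<lambda>n. ereal (\<Sum>i<n. \<gamma> ^ i * (s (Suc i) - s i))) \<and>
    limsup (\<lambda>n. ereal (\<Sum>i<n. \<gamma> ^ i * (s (Suc i) - s i))) \<le> ereal (K / (1 - \<gamma>))"
proof -
  define D where "D = max 1 (s 0 + B)"
  define \<epsilon> where "\<epsilon> = min 1 (a / (2 * D))"
  have D: "1 \<le> D" "s 0 + B \<le> D" by (auto simp: D_def)
  have \<epsilon>: "0 < \<epsilon>" using a D by (simp add: \<epsilon>_def)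
  have main: "ereal ((a / 2) / (1 - \<gamma>)) \<le> limsup (\<lambda>n. ereal (\<Sum>i<n. \<gamma> ^ i * (s (Suc i) - s i))) \<and>
      limsup (\<lambda>n. ereal (\<Sum>i<n. \<gamma> ^ i * (s (Suc i) - s i))) \<le> ereal (1 / (1 - \<gamma>))"
    if \<gamma>: "\<gamma> \<in> {1 - \<epsilon><..<1}" for \<gamma>
  proof
    have g: "0 < \<gamma>" "\<gamma> < 1" "1 - \<gamma> < a / (2 * D)" using \<gamma> by (auto simp: \<epsilon>_def)
    define t where "t i = s i - a * real i + B" for i
    have t: "0 \<le> t i" for i using lower[of i] by (simp add: t_def)
    have tel: "\<gamma> ^ n * t n - t 0 \<le> (\<Sum>i<n. \<gamma> ^ i * (t (Suc i) - t i))" for n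
    proof (induction n)
      case (Suc n)
      have "\<gamma> ^ Suc n * t (Suc n) \<le> \<gamma> ^ n * t (Suc n)"
        using g t[of "Suc n"] by (intro mult_right_mono power_decreasing) auto
      then show ?case using Suc by (simp add: algebra_simps)
    qed simp
    have low: "a * (\<Sum>i<n. \<gamma> ^ i) - D \<le> (\<Sum>i<n. \<gamma> ^ i * (s (Suc i) - s i))" for n
    proof -
      have "(\<Sum>i<n. \<gamma> ^ i * (s (Suc i) - s i)) = (\<Sum>i<n. \<gamma> ^ i * (t (Suc i) - t i) + a * \<gamma> ^ i)"
        by (intro sum.cong) (auto simp: t_def algebra_simps)
      also have "\<dots> = (\<Sum>i<n. \<gamma> ^ i * (t (Suc i) - t i)) + a * (\<Sum>i<n. \<gamma> ^ i)"
        by (simp add: sum.distrib sum_distrib_left)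
      finally show ?thesis
        using tel[of n] t[of n] g D by (simp add: t_def) (smt (verit) mult_nonneg_nonneg zero_le_power)
    qed
    have geo: "(\<lambda>n. \<Sum>i<n. \<gamma> ^ i) \<longlonglongrightarrow> 1 / (1 - \<gamma>)"
      using geometric_sums[of \<gamma>] g by (simp add: sums_def)
    have "D * (1 - \<gamma>) \<le> a / 2"
      using g D by (simp add: field_simps)
    moreover have "0 < 1 - \<gamma>" using g by simp
    ultimately have "D \<le> (a / 2) / (1 - \<gamma>)" by (simp only: pos_le_divide_eq)
    moreover have "a * (1 / (1 - \<gamma>)) = (a / 2) / (1 - \<gamma>) + (a / 2) / (1 - \<gamma>)"
      using add_divide_distrib[of "a / 2" "a / 2" "1 - \<gamma>"] by simp
    ultimately have "(a / 2) / (1 - \<gamma>) \<le> a * (1 / (1 - \<gamma>)) - D" by linarith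
    also have "ereal (a * (1 / (1 - \<gamma>)) - D) = limsup (\<lambda>n. ereal (a * (\<Sum>i<n. \<gamma> ^ i) - D))"
      by (intro lim_imp_Limsup[symmetric] tendsto_intros geo) simp
    also have "\<dots> \<le> limsup (\<lambda>n. ereal (\<Sum>i<n. \<gamma> ^ i * (s (Suc i) - s i)))"
      using low by (intro Limsup_mono) auto
    finally show "ereal ((a / 2) / (1 - \<gamma>)) \<le> limsup (\<lambda>n. ereal (\<Sum>i<n. \<gamma> ^ i * (s (Suc i) - s i)))"
      by simp
    have "limsup (\<lambda>n. ereal (\<Sum>i<n. \<gamma> ^ i * (s (Suc i) - s i))) \<le> limsup (\<lambda>n. ereal (\<Sum>i<n. \<gamma> ^ i))"
    proof (intro Limsup_mono always_eventually allI)
      fix n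
      have "(\<Sum>i<n. \<gamma> ^ i * (s (Suc i) - s i)) \<le> (\<Sum>i<n. \<gamma> ^ i * 1)"
        using incr g by (intro sum_mono mult_left_mono) auto
      then show "ereal (\<Sum>i<n. \<gamma> ^ i * (s (Suc i) - s i)) \<le> ereal (\<Sum>i<n. \<gamma> ^ i)" by simp
    qed
    also have "\<dots> = ereal (1 / (1 - \<gamma>))"
      by (intro lim_imp_Limsup tendsto_intros geo) simp
    finally show "limsup (\<lambda>n. ereal (\<Sum>i<n. \<gamma> ^ i * (s (Suc i) - s i))) \<le> ereal (1 / (1 - \<gamma>))" .
  qed
  show ?thesis
    using a \<epsilon> main by (intro exI[of _ "a / 2"] conjI exI[of _ 1] exI[of _ \<epsilon>]) auto
qed

context quadrant_llp
begin

lemma AE_start: "AE \<omega> in llp_law p \<phi> \<psi> \<beta>0 x. llp_X 0 \<omega> = x"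
proof -
  interpret L: prob_space "llp_law p \<phi> \<psi> \<beta>0 x" by (rule prob_space_llp_law)
  have "1 = measure_pmf.prob (trace_after p \<phi> \<psi> 0 ([x], \<beta>0)) {s. hd (fst s) = x}"
    by simp
  also have "\<dots> \<le> L.prob {\<omega>. llp_X 0 \<omega> = x}"
    using sets_llp_X[where P="\<lambda>z. z = x"] by (rule trace_le_law) simp
  finally have "L.prob {\<omega>. llp_X 0 \<omega> = x} = 1"
    using L.prob_le_1 by (simp add: antisym)
  then show ?thesis
    using L.prob_eq_1[OF sets_llp_X[where P="\<lambda>z. z = x"]] by simp
qed

lemma trace_last_step:
  assumes s: "s \<in> set_pmf (trace_after p \<phi> \<psi> (Suc n) ([x], \<beta>0))" and x: "x \<in> quadrant"
  obtains y z zs where "fst s = y # z # zs" "y \<in> quadrant" "z \<in> quadrant" "\<bar>size_of y - size_of z\<bar> \<le> 1"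
proof -
  from s obtain s0 where s0: "s0 \<in> set_pmf (trace_after p \<phi> \<psi> n ([x], \<beta>0))"
    and step: "s \<in> set_pmf (trace_step p \<phi> \<psi> s0)"
    unfolding trace_after_Suc_right set_bind_pmf by blast
  obtain xs b where s0_eq: "s0 = (xs, b)" by (cases s0)
  obtain a y where y: "y \<in> set_pmf (p (hd xs) a)" and s_eq: "s = (y # xs, env_update \<psi> b (hd xs) a y)"
    using step unfolding s0_eq set_trace_step by blast
  have "length xs = Suc n" "set xs \<subseteq> quadrant"
    using reachable_trace[OF s0 x] s0_eq by simp_all
  then obtain z zs where xs: "xs = z # zs" "z \<in> quadrant" by (cases xs) simp_all
  have yz: "y \<in> set_pmf (p z a)" using y xs(1) by simp
  then obtain d where "d \<in> unit_steps" "y = z + d" using set_transition[OF xs(2)] by blast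
  then have "\<bar>size_of y - size_of z\<bar> \<le> 1"
    by (auto simp: unit_steps_def size_of_def e1_def e2_def)
  then show thesis
    using that[of y z zs] s_eq xs transition_in_quadrant[OF xs(2)] yz by auto
qed

lemma AE_step:
  assumes x: "x \<in> quadrant"
  shows "AE \<omega> in llp_law p \<phi> \<psi> \<beta>0 x. llp_X n \<omega> \<in> quadrant \<and>
           \<bar>size_of (llp_X (Suc n) \<omega>) - size_of (llp_X n \<omega>)\<bar> \<le> 1"
proof -
  interpret L: prob_space "llp_law p \<phi> \<psi> \<beta>0 x" by (rule prob_space_llp_law)
  let ?Q = "\<lambda>zs. hd (tl zs) \<in> quadrant \<and> \<bar>size_of (hd zs) - size_of (hd (tl zs))\<bar> \<le> 1"
  let ?E = "{\<omega>. llp_X n \<omega> \<in> quadrant} \<inter>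
    {\<omega> \<in> space (llp_law p \<phi> \<psi> \<beta>0 x). \<bar>size_of (llp_X (Suc n) \<omega>) - size_of (llp_X n \<omega>)\<bar> \<le> 1}"
  have E: "?E \<in> sets (llp_law p \<phi> \<psi> \<beta>0 x)"
    by (intro sets.Int sets_llp_X[where P="\<lambda>z. z \<in> quadrant"]) measurable
  have "?Q (fst s)" if "s \<in> set_pmf (trace_after p \<phi> \<psi> (Suc n) ([x], \<beta>0))" for s
    using trace_last_step[OF that x] by (metis list.sel(1,3))
  then have "1 = measure_pmf.prob (trace_after p \<phi> \<psi> (Suc n) ([x], \<beta>0)) {s. ?Q (fst s)}"
    by (subst eq_commute, subst measure_pmf.prob_eq_1) (auto simp only: AE_measure_pmf_iff sets_measure_pmf UNIV_I mem_Collect_eq)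
  also have "\<dots> \<le> L.prob ?E"
    using E by (rule trace_le_law) (simp add: space_llp_law)
  finally have "L.prob ?E = 1"
    using L.prob_le_1[of ?E] by (intro antisym)
  then have "AE \<omega> in llp_law p \<phi> \<psi> \<beta>0 x. \<omega> \<in> ?E"
    by (simp only: L.prob_eq_1[OF E])
  then show ?thesis by eventually_elim blast
qed

lemma AE_size_bounds:
  assumes x: "x \<in> quadrant"
  shows "AE \<omega> in llp_law p \<phi> \<psi> \<beta>0 x. 0 \<le> size_of (llp_X n \<omega>) \<and> size_of (llp_X n \<omega>) \<le> size_of x + n"
proof -
  have nonneg: "0 \<le> size_of z" if "z \<in> quadrant" for z
    using that by (simp add: quadrant_def size_of_def)
  have "AE \<omega> in llp_law p \<phi> \<psi> \<beta>0 x. size_of (llp_X n \<omega>) \<le> size_of x + n"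
  proof (induction n)
    case 0
    show ?case using AE_start by eventually_elim simp
  next
    case (Suc n)
    show ?case using Suc AE_step[OF x, of n] by eventually_elim auto
  qed
  then show ?thesis using AE_step[OF x, of n] by eventually_elim (use nonneg in blast)
qed

lemma integrable_size:
  assumes x: "x \<in> quadrant"
  shows "integrable (llp_law p \<phi> \<psi> \<beta>0 x) (\<lambda>\<omega>. size_of (llp_X n \<omega>))"
proof -
  interpret L: prob_space "llp_law p \<phi> \<psi> \<beta>0 x" by (rule prob_space_llp_law)
  show ?thesis
  proof (rule L.integrable_const_bound[where B="size_of x + n"])
    show "AE \<omega> in llp_law p \<phi> \<psi> \<beta>0 x. norm (size_of (llp_X n \<omega>)) \<le> size_of x + n"
      using AE_size_bounds[OF x, of n] by eventually_elim simp
  qed measurable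
qed

abbreviation mean_size :: "state \<Rightarrow> nat \<Rightarrow> real" where
  "mean_size x n \<equiv> (\<integral>\<omega>. size_of (llp_X n \<omega>) \<partial>llp_law p \<phi> \<psi> \<beta>0 x)"

lemma llp_J_eq:
  assumes x: "x \<in> quadrant"
  shows "llp_J p \<phi> \<psi> \<beta>0 \<gamma> x =
    limsup (\<lambda>n. ereal (\<Sum>i<n. \<gamma> ^ i * (mean_size x (Suc i) - mean_size x i)))"
proof -
  have "(\<integral>\<omega>. (\<Sum>i<n. \<gamma> ^ i * cost (llp_X i \<omega>) (llp_A i \<omega>) (llp_X (Suc i) \<omega>)) \<partial>llp_law p \<phi> \<psi> \<beta>0 x) =
      (\<Sum>i<n. \<gamma> ^ i * (mean_size x (Suc i) - mean_size x i))" for n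
    unfolding cost_eq_size_diff using integrable_size[OF x] by simp
  then show ?thesis by (simp add: llp_J_def)
qed

lemma mean_size_increment:
  assumes x: "x \<in> quadrant"
  shows "mean_size x (Suc n) - mean_size x n \<le> 1"
proof -
  interpret L: prob_space "llp_law p \<phi> \<psi> \<beta>0 x" by (rule prob_space_llp_law)
  have "mean_size x (Suc n) \<le> (\<integral>\<omega>. size_of (llp_X n \<omega>) + 1 \<partial>llp_law p \<phi> \<psi> \<beta>0 x)"
    using AE_step[OF x, of n] by (intro integral_mono_AE Bochner_Integration.integrable_add integrable_size[OF x]) auto
  also have "\<dots> = mean_size x n + 1"
    using integrable_size[OF x] by (simp add: L.prob_space)
  finally show ?thesis by simp
qed

end

context drifting_llp
begin

text \<open>On the escape event, whose probability has a positive lower bound independent of \<open>n\<close>, both coordinates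
exceed a linear function of \<open>n\<close>; elsewhere the size is nonnegative.\<close>

lemma mean_size_linear:
  assumes irr: "llp_irreducible p \<phi> \<psi> \<beta>0" and x: "x \<in> quadrant"
  shows "\<exists>a>0. \<exists>B. \<forall>n. a * real n - B \<le> mean_size x n"
proof -
  interpret L: prob_space "llp_law p \<phi> \<psi> \<beta>0 x" by (rule prob_space_llp_law)
  obtain m xs b where s: "(xs, b) \<in> set_pmf (trace_after p \<phi> \<psi> m ([x], \<beta>0))"
    "hd xs \<in> interior_sites" "set (tl xs) \<inter> interior_sites = {}"
    using interior_entrance[OF irr x] by blast
  have reach: "unvisited_initial (xs, b)" "length xs = Suc m"
    using reachable_trace[OF s(1) x] by simp_all
  then have "xs \<noteq> []" by auto
  let ?c = "\<eta> / 2"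
  obtain C T \<epsilon> where \<epsilon>: "0 < \<epsilon>" and esc: "\<And>n. \<epsilon> \<le> measure_pmf.prob (trace_after p \<phi> \<psi> (T + n) (xs, b))
      {s. follows (escape_region (hd xs) m ?c C) (fst s)}"
    using escape_probability[OF \<open>xs \<noteq> []\<close> s(2,3) reach] by blast
  define R where "R = escape_region (hd xs) m ?c C"
  define \<delta> where "\<delta> = pmf (trace_after p \<phi> \<psi> m ([x], \<beta>0)) (xs, b) * \<epsilon>"
  have \<delta>: "0 < \<delta>" using s(1) \<epsilon> by (simp add: \<delta>_def pmf_positive)
  have prob: "\<delta> \<le> L.prob {\<omega>. llp_X n \<omega> \<in> R n}" for n
  proof -
    have "\<delta> \<le> pmf (trace_after p \<phi> \<psi> m ([x], \<beta>0)) (xs, b) *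
        measure_pmf.prob (trace_after p \<phi> \<psi> (T + n) (xs, b)) {s. follows R (fst s)}"
      unfolding \<delta>_def R_def using esc by (intro mult_left_mono) auto
    also have "\<dots> \<le> measure_pmf.prob (trace_after p \<phi> \<psi> (m + (T + n)) ([x], \<beta>0)) {s. follows R (fst s)}"
      unfolding trace_after_add[of p \<phi> \<psi> m] by (rule prob_bind_pmf_ge)
    also have "\<dots> \<le> L.prob {\<omega>. llp_X n \<omega> \<in> R n}"
    proof (rule trace_le_law[OF sets_llp_X[where P="\<lambda>z. z \<in> R n"]])
      fix \<omega> assume "follows R (map (\<lambda>i. llp_X i \<omega>) (rev [0..<Suc (m + (T + n))]))"
      then show "\<omega> \<in> {\<omega>. llp_X n \<omega> \<in> R n}" unfolding follows_map_rev by simp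
    qed
    finally show ?thesis .
  qed
  have lower: "\<delta> * (?c * (real n - real m) - \<bar>C\<bar>) \<le> mean_size x n" for n
  proof -
    \<comment> \<open>With \<open>\<bar>C\<bar>\<close> in place of \<open>C\<close> the bound is nonpositive before time \<open>m\<close>.\<close>
    let ?h = "?c * (real n - real m) - \<bar>C\<bar>"
    have nonneg: "0 \<le> mean_size x n"
      using AE_size_bounds[OF x, of n] by (intro integral_nonneg_AE) auto
    show ?thesis
    proof (cases "m \<le> n \<and> 0 \<le> ?h")
      case True
      have ge: "?h * indicator {\<omega>. llp_X n \<omega> \<in> R n} \<omega> \<le> size_of (llp_X n \<omega>)"
        if "0 \<le> size_of (llp_X n \<omega>)" for \<omega>
      proof (cases "llp_X n \<omega> \<in> R n")
        case R: True
        have "?c * (real n - real m) - C \<le> fst (llp_X n \<omega>)" "?c * (real n - real m) - C \<le> snd (llp_X n \<omega>)"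
          using R True by (simp_all add: R_def escape_region_def to_plane_coordinates)
        then have "?h \<le> fst (llp_X n \<omega>)" "?h \<le> snd (llp_X n \<omega>)" by linarith+
        then show ?thesis using R True by (simp add: size_of_def)
      qed (use that in simp)
      have "\<delta> * ?h \<le> L.prob {\<omega>. llp_X n \<omega> \<in> R n} * ?h"
        using prob[of n] True by (intro mult_right_mono) auto
      also have "\<dots> = (\<integral>\<omega>. ?h * indicator {\<omega>. llp_X n \<omega> \<in> R n} \<omega> \<partial>llp_law p \<phi> \<psi> \<beta>0 x)"
        by (simp add: space_llp_law)
      also have "\<dots> \<le> mean_size x n"
      proof (rule integral_mono_AE)
        show "integrable (llp_law p \<phi> \<psi> \<beta>0 x) (\<lambda>\<omega>. ?h * indicator {\<omega>. llp_X n \<omega> \<in> R n} \<omega>)"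
          using sets_llp_X[where P="\<lambda>z. z \<in> R n"] by (intro integrable_mult_right integrable_real_indicator)
            (simp_all flip: less_top)
        show "AE \<omega> in llp_law p \<phi> \<psi> \<beta>0 x. ?h * indicator {\<omega>. llp_X n \<omega> \<in> R n} \<omega> \<le> size_of (llp_X n \<omega>)"
          using AE_size_bounds[OF x, of n] by eventually_elim (use ge in blast)
      qed (rule integrable_size[OF x])
      finally show ?thesis .
    next
      case False
      moreover have "?h \<le> 0" if "n < m"
      proof -
        have "?c * (real n - real m) \<le> 0" using that eta_pos by (intro mult_nonneg_nonpos) auto
        then show ?thesis by linarith
      qed
      ultimately have "?h \<le> 0" by linarith
      then have "\<delta> * ?h \<le> 0" using \<delta> by (intro mult_nonneg_nonpos) auto
      then show ?thesis using nonneg by linarith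
    qed
  qed
  have "\<delta> * ?c * real n - \<delta> * (?c * real m + \<bar>C\<bar>) \<le> mean_size x n" for n
    using lower[of n] by (simp add: algebra_simps)
  moreover have "0 < \<delta> * ?c" using \<delta> eta_pos by simp
  ultimately show ?thesis by blast
qed

lemma transient_and_linear_cost:
  assumes irr: "llp_irreducible p \<phi> \<psi> \<beta>0"
  shows "llp_transient p \<phi> \<psi> \<beta>0"
    and "x \<in> quadrant \<Longrightarrow> \<exists>k>0. \<exists>K>0. \<exists>\<epsilon>>0. \<forall>\<gamma>\<in>{1 - \<epsilon><..<1}.
           ereal (k / (1 - \<gamma>)) \<le> llp_J p \<phi> \<psi> \<beta>0 \<gamma> x \<and> llp_J p \<phi> \<psi> \<beta>0 \<gamma> x \<le> ereal (K / (1 - \<gamma>))"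
proof -
  show "llp_transient p \<phi> \<psi> \<beta>0"
    using irr avoids_bounded_set unfolding llp_transient_def by blast
next
  assume x: "x \<in> quadrant"
  obtain a B where "0 < a" "\<And>n. a * real n - B \<le> mean_size x n"
    using mean_size_linear[OF irr x] by blast
  from discounted_increments_order[of "mean_size x", OF mean_size_increment[OF x] this]
  show "\<exists>k>0. \<exists>K>0. \<exists>\<epsilon>>0. \<forall>\<gamma>\<in>{1 - \<epsilon><..<1}.
           ereal (k / (1 - \<gamma>)) \<le> llp_J p \<phi> \<psi> \<beta>0 \<gamma> x \<and> llp_J p \<phi> \<psi> \<beta>0 \<gamma> x \<le> ereal (K / (1 - \<gamma>))"
    unfolding llp_J_eq[OF x] .
qed

end

section \<open>The range of exploration probabilities\<close>

theorem theorem4p1: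
  fixes p :: "state \<Rightarrow> action \<Rightarrow> state pmf"
  assumes "model1 p"
  shows "\<exists>q0 q1 :: real. 0 < q0 \<and> q0 < q1 \<and> q1 \<le> 1 \<and>
    (\<forall>(\<phi> :: decision_rule) (\<psi> :: update_rule) (\<beta>0 :: env).
       admissible_llp \<phi> \<beta>0 \<and> llp_irreducible p \<phi> \<psi> \<beta>0 \<and>
       (\<forall>x\<in>quadrant. q0 < pmf (\<phi> (\<beta>0 x)) Act_r \<and> pmf (\<phi> (\<beta>0 x)) Act_r < q1) \<longrightarrow>
         llp_transient p \<phi> \<psi> \<beta>0 \<and>
         (\<forall>x\<in>quadrant. \<exists>k>0. \<exists>K>0. \<exists>\<epsilon>>0. \<forall>\<gamma>\<in>{1 - \<epsilon><..<1}.
            ereal (k / (1 - \<gamma>)) \<le> llp_J p \<phi> \<psi> \<beta>0 \<gamma> x \<and>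
            llp_J p \<phi> \<psi> \<beta>0 \<gamma> x \<le> ereal (K / (1 - \<gamma>))))"
proof -
  obtain \<mu> \<mu>' \<mu>'' v l \<rho> \<alpha>0 \<alpha>1 where
    trans: "quadrant_transitions p \<mu> \<mu>' \<mu>''" and v: "v \<in> real_quadrant"
    and v_neg: "\<forall>w\<in>{drift (\<mu> Act_g), drift (\<mu>' Act_g), drift (\<mu>'' Act_g)}. w \<bullet> v < 0"
    and l: "norm l = 1" and \<rho>: "\<rho> = min (drift (\<mu> Act_r) \<bullet> l) (drift (\<mu> Act_g) \<bullet> l)" "0 < \<rho>"
    and \<alpha>: "0 < \<alpha>0" "\<alpha>0 < \<alpha>1" "\<alpha>1 \<le> 1"
    and mix: "\<forall>\<delta>\<in>{\<alpha>0<..<\<alpha>1}. \<delta> *\<^sub>R drift (\<mu> Act_r) + (1 - \<delta>) *\<^sub>R drift (\<mu> Act_g) \<in> real_quadrant"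
    and gap: "1 - \<alpha>1 < \<rho> - \<alpha>0"
    using assms unfolding model1_def by blast
  let ?r = "drift (\<mu> Act_r)" and ?g = "drift (\<mu> Act_g)"
  have gv: "?g \<bullet> v < 0" using v_neg by blast
  have mu: "\<mu> a \<in> step_dists" for a
    using trans unfolding quadrant_transitions_def by blast
  have \<rho>1: "\<rho> \<le> 1" using drift_inner_le_1[OF mu[of Act_r] l] \<rho>(1) by simp
  have \<rho>_le: "\<rho> \<le> ?r \<bullet> l" "\<rho> \<le> ?g \<bullet> l" using \<rho>(1) by simp_all
  have l_pos: "0 < ?r \<bullet> l" "0 < ?g \<bullet> l" using \<rho>_le \<rho>(2) by linarith+
  have mix_nonneg: "0 \<le> \<delta> * fst ?r + (1 - \<delta>) * fst ?g" "0 \<le> \<delta> * snd ?r + (1 - \<delta>) * snd ?g"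
    if "\<delta> \<in> {\<alpha>0<..<\<alpha>1}" for \<delta>
    using mix that by (auto simp: real_quadrant_def)
  obtain \<delta>' where \<delta>': "\<delta>' \<in> {\<alpha>0<..<\<alpha>1}" using dense[OF \<alpha>(2)] by auto
  then have \<delta>'01: "0 < \<delta>'" "\<delta>' < 1" using \<alpha> by auto
  have ne1: "\<not> (fst ?r = 0 \<and> fst ?g = 0)"
    using drift_coordinate_nonzero[of "fst v" "snd v" "fst ?g" "snd ?g" "fst ?r" "fst l" "snd ?r" "snd l" \<delta>']
      v gv l_pos \<delta>'01 mix_nonneg(2)[OF \<delta>'] by (simp add: real_quadrant_def inner_prod_def)
  have ne2: "\<not> (snd ?r = 0 \<and> snd ?g = 0)"
    using drift_coordinate_nonzero[of "snd v" "fst v" "snd ?g" "fst ?g" "snd ?r" "snd l" "fst ?r" "fst l" \<delta>']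
      v gv l_pos \<delta>'01 mix_nonneg(1)[OF \<delta>'] by (simp add: real_quadrant_def inner_prod_def add.commute)
  have mix_pos: "0 < \<delta> * (?r \<bullet> to_plane e) + (1 - \<delta>) * (?g \<bullet> to_plane e)"
    if "e \<in> {e1, e2}" "\<delta> \<in> {\<alpha>0<..<\<alpha>1}" for e \<delta>
  proof -
    have "e = e1 \<or> e = e2" using that(1) by simp
    then show ?thesis
    proof
      assume "e = e1"
      then show ?thesis
        using affine_pos_if_nonneg_around[OF mix_nonneg(1) ne1 that(2)] by (simp add: drift_coordinates)
    next
      assume "e = e2"
      then show ?thesis
        using affine_pos_if_nonneg_around[OF mix_nonneg(2) ne2 that(2)] by (simp add: drift_coordinates)
    qed
  qed
  define q0 where "q0 = \<alpha>0 / \<rho>"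
  define q1 where "q1 = (\<alpha>1 - 1 + \<rho>) / \<rho>"
  have q01: "0 < q0" "q0 < q1" "q1 \<le> 1"
    using \<alpha> \<rho>(2) gap by (auto simp: q0_def q1_def divide_strict_right_mono pos_divide_le_eq)
  have main: "llp_transient p \<phi> \<psi> \<beta>0 \<and>
         (\<forall>x\<in>quadrant. \<exists>k>0. \<exists>K>0. \<exists>\<epsilon>>0. \<forall>\<gamma>\<in>{1 - \<epsilon><..<1}.
            ereal (k / (1 - \<gamma>)) \<le> llp_J p \<phi> \<psi> \<beta>0 \<gamma> x \<and>
            llp_J p \<phi> \<psi> \<beta>0 \<gamma> x \<le> ereal (K / (1 - \<gamma>)))"
    if adm: "admissible_llp \<phi> \<beta>0" and irr: "llp_irreducible p \<phi> \<psi> \<beta>0"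
      and q_range: "\<forall>x\<in>quadrant. q0 < pmf (\<phi> (\<beta>0 x)) Act_r \<and> pmf (\<phi> (\<beta>0 x)) Act_r < q1"
    for \<phi> \<psi> \<beta>0
  proof -
    interpret Q: quadrant_llp p \<mu> \<mu>' \<mu>'' \<phi> \<psi> \<beta>0
      by standard (fact trans adm)+
    let ?q = Q.fresh_prob
    have "(0, 0) \<in> quadrant" by (simp add: quadrant_def)
    then have q: "q0 < ?q" "?q < q1" using q_range unfolding Q.fresh_prob_def by blast+
    \<comment> \<open>The two bounds for the frequency of \<open>r\<close>, in the form used by \<open>exists_compensator\<close>.\<close>
    have q\<rho>: "\<alpha>0 < ?q * \<rho>" "?q * \<rho> < \<alpha>1 - 1 + \<rho>"
      using q \<rho>(2) by (simp_all add: q0_def q1_def pos_divide_less_eq pos_less_divide_eq)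
    have "?q * \<rho> \<le> ?q * 1" "(1 - ?q) * \<rho> \<le> (1 - ?q) * 1"
      using \<rho>1 Q.fresh_prob_bounds by (intro mult_left_mono; simp)+
    \<comment> \<open>\<open>\<rho> \<le> 1\<close> makes \<open>q\<close> itself an admissible frequency, so the drift at fresh sites points strictly
      into the quadrant.\<close>
    then have q\<alpha>: "?q \<in> {\<alpha>0<..<\<alpha>1}"
      using q\<rho> by (auto simp: algebra_simps)
    define good where "good e \<beta> \<eta> \<longleftrightarrow> 0 \<le> \<beta> \<and> 0 < \<eta> \<and>
        \<eta> \<le> Q.fresh_drift \<bullet> (to_plane e + \<beta> *\<^sub>R l) - \<beta> \<and>
        (\<forall>a. \<eta> \<le> drift (\<mu> a) \<bullet> (to_plane e + \<beta> *\<^sub>R l))" for e \<beta> \<eta>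
    have ex_good: "\<exists>\<beta> \<eta>. good e \<beta> \<eta>" if e: "e \<in> {e1, e2}" for e
    proof -
      obtain \<beta> \<eta> where b: "0 \<le> \<beta>" "0 < \<eta>"
        "\<eta> \<le> ?q * (?r \<bullet> to_plane e + \<beta> * (?r \<bullet> l)) + (1 - ?q) * (?g \<bullet> to_plane e + \<beta> * (?g \<bullet> l)) - \<beta>"
        "\<eta> \<le> ?r \<bullet> to_plane e + \<beta> * (?r \<bullet> l)" "\<eta> \<le> ?g \<bullet> to_plane e + \<beta> * (?g \<bullet> l)"
        using exists_compensator[OF mix_pos[OF e] \<rho>_le _ _ q\<rho> \<alpha>(2)] Q.fresh_prob_bounds by auto
      have "\<eta> \<le> drift (\<mu> a) \<bullet> (to_plane e + \<beta> *\<^sub>R l)" for a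
        using b(4,5) by (cases a) (simp_all add: inner_add_right)
      moreover have "\<eta> \<le> Q.fresh_drift \<bullet> (to_plane e + \<beta> *\<^sub>R l) - \<beta>"
        using b(3) by (simp add: Q.fresh_drift_def inner_add_left inner_add_right algebra_simps)
      ultimately show ?thesis using b(1,2) unfolding good_def by blast
    qed
    obtain \<beta>1 \<eta>1 where g1: "good e1 \<beta>1 \<eta>1" using ex_good[of e1] by blast
    obtain \<beta>2 \<eta>2 where g2: "good e2 \<beta>2 \<eta>2" using ex_good[of e2] by blast
    define \<beta> where "\<beta> e = (if e = e1 then \<beta>1 else \<beta>2)" for e :: state
    define \<eta> where "\<eta> = min \<eta>1 \<eta>2"
    have "e1 \<noteq> e2" by (simp add: e1_def e2_def)
    have good_mono: "good e b h'" if "good e b h" "0 < h'" "h' \<le> h" for e b h h'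
      using that unfolding good_def by (meson order_trans)
    have "0 < \<eta>1" "0 < \<eta>2" using g1 g2 unfolding good_def by blast+
    then have "good e1 \<beta>1 \<eta>" "good e2 \<beta>2 \<eta>"
      by (auto simp: \<eta>_def intro: good_mono[OF g1] good_mono[OF g2])
    then have good: "good e (\<beta> e) \<eta>" if "e \<in> {e1, e2}" for e
      using that \<open>e1 \<noteq> e2\<close> by (auto simp: \<beta>_def)
    have \<eta>: "0 < \<eta>" using good[of e1] unfolding good_def by simp
    have fresh_pos: "0 < fst Q.fresh_drift" "0 < snd Q.fresh_drift"
      using mix_pos[OF _ q\<alpha>, of e1] mix_pos[OF _ q\<alpha>, of e2]
      by (simp_all add: Q.fresh_drift_def drift_coordinates)
    interpret drifting_llp p \<mu> \<mu>' \<mu>'' \<phi> \<psi> \<beta>0 l \<beta> \<eta>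
      by standard (use l \<eta> fresh_pos good good_def in blast)+
    show ?thesis using transient_and_linear_cost[OF irr] by blast
  qed
  show ?thesis
    using q01 main by (intro exI[of _ q0] exI[of _ q1]) blast
qed

end
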